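(* Let $G:\mathbb{R}^p\to\mathbb{R}^p$ be $\beta$-co-coercive for some $\beta>0$, i.e. $\langle Gx-Gy,x-y\rangle\ge\beta\|Gx-Gy\|^2$ for all $x,y\in\mathbb{R}^p$, with $\mathrm{zer}(G):=\{x:Gx=0\}\neq\emptyset$. Let $\{(x^k,y^k,z^k)\}$ be generated by the accelerated fixed-point (AFP) scheme of the context using the delayed oracle $\widetilde G^k:=Gy^{k-\tau_k}$ with uniformly bounded integer delays $0\le\tau_k\le\tau$ for some $\tau\ge1$, where, with $\Lambda:=1+s-\gamma$, the parameters are $$\gamma_k:=\gamma\in(0,1],\quad s\ge1+3\gamma,\quad 0<\eta\le\frac{3\beta}{3+(7\Lambda+3)\tau},\quad t_k:=k+3s+\tau,\quad\eta_k:=\frac{\eta t_k}{2(t_k-s)}.$$ Let $x^\star\in\mathrm{zer}(G)$. Then: (i) (Convergence in expectation.) For $\mathcal{R}_0^2:=\frac{\eta(3s+\tau-1)^2}{2}\|Gy^0\|^2+\frac{2s^3}{\eta\gamma}\|y^0-x^\star\|^2$, $$\mathbb{E}[\|Gy^k\|^2]\le\frac{4\mathcal{R}_0^2}{\eta(k+3s+\tau-1)^2}\qquad\text{and}\qquad\lim_{k\to\infty}(k+\tau)^2\,\mathbb{E}[\|Gy^k\|^2]=0.$$ (ii) (Almost sure convergence.) Almost surely, $\sum_{k=0}^\infty(k+\tau)\|Gy^k\|^2<+\infty$ and $\lim_{k\to\infty}(k+\tau)^2\|Gy^k\|^2=0$. Moreover, $\{x^k\}$, $\{y^k\}$ and $\{z^k\}$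 converge almost surely to a $\mathrm{zer}(G)$-valued random variable, i.e. a zero of $G$. (iii) (Iteration-complexity.) For any given tolerance $\epsilon>0$, at most $\mathcal{O}\big(\frac{\tau}{\epsilon}+\frac{\tau}{\beta\epsilon}\big)$ iterations are required to achieve $\mathbb{E}[\|Gy^k\|^2]\le\epsilon^2$.
   Context: AFP scheme. Given a constant $s>1$ and an initial point $y^0\in\mathbb{R}^p$, set $z^0:=y^0$. At each iteration $k\ge0$, with $\widetilde G^k$ an estimator of $Gy^k$, $$x^{k+1}:=y^k-\eta_k\widetilde G^k,\qquad z^{k+1}:=z^k+\tfrac{\gamma_k}{s}(x^{k+1}-y^k),\qquad y^{k+1}:=\tfrac{t_k-s}{t_k}x^{k+1}+\tfrac{s}{t_k}z^{k+1}.$$ Convention: $y^{j}:=y^0$ for $j<0$. Expectations and "almost surely" refer to the randomness (if any) in the procedure, e.g. in the delays. *)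

theory Defs
  imports "HOL-Probability.Probability"
begin

definition zer :: "('a \<Rightarrow> 'b::zero) \<Rightarrow> 'a set" where
  "zer G = {x. G x = 0}"

definition cocoercive :: "real \<Rightarrow> ('a::real_inner \<Rightarrow> 'a) \<Rightarrow> bool" where
  "cocoercive \<beta> G \<longleftrightarrow> (\<forall>x y. (G x - G y) \<bullet> (x - y) \<ge> \<beta> * (norm (G x - G y))\<^sup>2)"

(* One trajectory of the accelerated fixed-point scheme, for arbitrary parameter sequences and
   an arbitrary sequence Gt of estimators.  The scheme produces x only from index 1 on, so
   x 0 is left unconstrained. *)
definition afp_scheme ::
  "real \<Rightarrow> (nat \<Rightarrow> real) \<Rightarrow> (nat \<Rightarrow> real) \<Rightarrow> (nat \<Rightarrow> real) \<Rightarrow> 'a::real_vector \<Rightarrow> (nat \<Rightarrow> 'a) \<Rightarrow>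
   (nat \<Rightarrow> 'a) \<Rightarrow> (nat \<Rightarrow> 'a) \<Rightarrow> (nat \<Rightarrow> 'a) \<Rightarrow> bool" where
  "afp_scheme s \<gamma> \<eta> t y0 Gt x y z \<longleftrightarrow>
     s > 1 \<and> y 0 = y0 \<and> z 0 = y0 \<and>
     (\<forall>k. x (Suc k) = y k - \<eta> k *\<^sub>R Gt k \<and>
          z (Suc k) = z k + (\<gamma> k / s) *\<^sub>R (x (Suc k) - y k) \<and>
          y (Suc k) = ((t k - s) / t k) *\<^sub>R x (Suc k) + (s / t k) *\<^sub>R z (Suc k))"

definition afp_t :: "real \<Rightarrow> nat \<Rightarrow> nat \<Rightarrow> real" where
  "afp_t s \<tau> k = real k + 3 * s + real \<tau>"

definition afp_eta :: "real \<Rightarrow> real \<Rightarrow> nat \<Rightarrow> nat \<Rightarrow> real" where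
  "afp_eta \<eta> s \<tau> k = \<eta> * afp_t s \<tau> k / (2 * (afp_t s \<tau> k - s))"

definition afp_eta_max :: "real \<Rightarrow> real \<Rightarrow> real \<Rightarrow> nat \<Rightarrow> real" where
  "afp_eta_max \<beta> s \<gamma> \<tau> = (let \<Lambda> = 1 + s - \<gamma> in 3 * \<beta> / (3 + (7 * \<Lambda> + 3) * real \<tau>))"

(* The iterates are random only through the delays d k.  No independence or distributional
   assumption is made on the delays.  Since subtraction on nat truncates at 0, the index
   k - d k \<omega> implements the convention that the iterate with a negative index is y 0. *)
locale afp_delayed = prob_space M
  for M :: "'w measure" +
  fixes G :: "real ^ 'n \<Rightarrow> real ^ 'n"
    and \<beta> s \<gamma> \<eta> :: real
    and \<tau> :: nat
    and d :: "nat \<Rightarrow> 'w \<Rightarrow> nat"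
    and y0 :: "real ^ 'n"
    and x y z :: "nat \<Rightarrow> 'w \<Rightarrow> real ^ 'n"
  assumes beta_pos: "\<beta> > 0"
    and G_cocoercive: "cocoercive \<beta> G"
    and zer_nonempty: "zer G \<noteq> {}"
    and tau_ge_1: "\<tau> \<ge> 1"
    and delay_measurable: "\<And>k. d k \<in> measurable M (count_space UNIV)"
    and delay_bound: "\<And>k \<omega>. \<omega> \<in> space M \<Longrightarrow> d k \<omega> \<le> \<tau>"
    and gamma_pos: "0 < \<gamma>" and gamma_le_1: "\<gamma> \<le> 1"
    and s_ge: "s \<ge> 1 + 3 * \<gamma>"
    and eta_pos: "0 < \<eta>" and eta_le: "\<eta> \<le> afp_eta_max \<beta> s \<gamma> \<tau>"
    and scheme: "\<And>\<omega>. \<omega> \<in> space M \<Longrightarrow>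
      afp_scheme s (\<lambda>_. \<gamma>) (afp_eta \<eta> s \<tau>) (afp_t s \<tau>) y0
        (\<lambda>k. G (y (k - d k \<omega>) \<omega>)) (\<lambda>k. x k \<omega>) (\<lambda>k. y k \<omega>) (\<lambda>k. z k \<omega>)"

end

(* Every trajectory is treated separately; expectations only enter through pathwise bounds.
   Write g_k = G(y_k), h_k = G(y_{k-d_k}), v_k = y_k - z_k.  Co-coercivity between consecutive
   iterates y_k, y_{k+1} and between the delayed iterate and a zero gives a decrease of
     (eta/4) (t_k - 1) (m_k - 1) |g_k|^2 + s (m_k - 1) <g_k, v_k> + c_k |z_k - x*|^2
   up to errors caused by the delay.  The errors h_k - g_k are window sums of the differences
   g_{j+1} - g_j, whose weighted squares are produced by the decrease; those involving v_k are
   controlled by the linear recursion v_{k+1} = (1 - s/t_k) v_k - const h_k.  Summing over k, the step size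
   bound lets the gains absorb the errors.  The o(1/k^2) rate follows because the first two terms form a
   convergent sequence whose quotient by t_k is summable, and convergence of the iterates is
   quasi-Fejer monotonicity of z_k with respect to the zeros of G.

   The weight is m_k = t_k + b instead of t_k: since the step size eta_k varies with k, b has to be
   large enough for the coefficient c_k of |z_k - x*|^2 to be nonincreasing. *)
theory Submission
  imports Defs
begin

section \<open>Inequalities and sequences\<close>

text \<open>The obstacle is that the errors feed on each other: e_k is paid in |D_j|^2, the drift
  y_k - y_{k-d_k} in |h_j|^2 and |v_j|^2, and |v_j|^2 again in |h_j|^2. The chain closes because two
  gains absorb everything: about (2/3) \<beta> m t |D|^2 from consecutive iterates and about s
  \<beta> \<kappa> |h|^2 from co-coercivity at the delayed point. A window sum with the growing
  weights m t costs a factor (7/3) T, one with the nonincreasing weights \<kappa> only T, so each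
  error ends as a gain times \<eta> / \<beta>, \<eta> T / \<beta>, its square, or a small fixed
  fraction. As 7 \<Lambda> + 3 = 17 + 7 (s - \<gamma> - 1), the step size bound gives \<eta> T <= 3
  \<beta> / 17, and the numerical constants are chosen to make this enough. Only <e_k, g_k> needs
  the part of the bound that grows with s. The indefinite term <g_k, v_k> is not estimated in the
  Lyapunov sum: c_k is determined by the requirement that the z-step cancel it, and the monotonicity
  of this c_k then dictates the size of b.\<close>

lemma inner_Young:
  fixes u w :: "'a::real_inner"
  assumes "q > 0"
  shows "- (q * (norm u)\<^sup>2 + (norm w)\<^sup>2 / (4 * q)) \<le> u \<bullet> w"
proof -
  have "0 \<le> (norm ((2 * q) *\<^sub>R u + w))\<^sup>2" by simp
  also have "\<dots> = 4 * q * (q * (norm u)\<^sup>2 + (norm w)\<^sup>2 / (4 * q) + u \<bullet> w)"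
    using assms unfolding power2_norm_eq_inner
    by (simp add: inner_add_left inner_add_right inner_commute field_simps)
  finally show ?thesis using assms by (simp add: zero_le_mult_iff)
qed

lemma norm_sum_squared_le:
  fixes f :: "'b \<Rightarrow> 'a::real_normed_vector"
  shows "(norm (\<Sum>i\<in>I. f i))\<^sup>2 \<le> real (card I) * (\<Sum>i\<in>I. (norm (f i))\<^sup>2)"
proof -
  have "(norm (\<Sum>i\<in>I. f i))\<^sup>2 \<le> (\<Sum>i\<in>I. norm (f i))\<^sup>2"
    by (intro power_mono norm_sum) auto
  also have "\<dots> \<le> (\<Sum>i\<in>I. (norm (f i))\<^sup>2) * real (card I)"
    by (rule sum_squared_le_sum_of_squares)
  finally show ?thesis by (simp add: mult.commute)
qed

text \<open>Exchange the sums: j lies exactly in the windows of k = j + 1, ..., j + \<tau>, and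
  admitting those k beyond K only enlarges the right side.\<close>

lemma sum_window_le:
  fixes a f :: "nat \<Rightarrow> real"
  assumes "\<And>k. a k \<ge> 0" "\<And>k. f k \<ge> 0"
  shows "(\<Sum>k<K. a k * (\<Sum>j\<in>{k - \<tau>..<k}. f j)) \<le> (\<Sum>j<K. f j * (\<Sum>i\<in>{1..\<tau>}. a (j + i)))"
proof -
  have "(\<Sum>k<K. a k * (\<Sum>j\<in>{k - \<tau>..<k}. f j))
      = (\<Sum>k<K. \<Sum>j<K. if j \<in> {k - \<tau>..<k} then f j * a k else 0)"
  proof (intro sum.cong refl)
    fix k assume "k \<in> {..<K}"
    then have "{..<K} \<inter> {k - \<tau>..<k} = {k - \<tau>..<k}" by auto
    then show "a k * (\<Sum>j\<in>{k - \<tau>..<k}. f j) = (\<Sum>j<K. if j \<in> {k - \<tau>..<k} then f j * a k else 0)"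
      using sum.inter_restrict[of "{..<K}" "\<lambda>j. f j * a k" "{k - \<tau>..<k}"]
      by (simp only: sum_distrib_left mult.commute[of "a k"] finite_lessThan)
  qed
  also have "\<dots> = (\<Sum>j<K. \<Sum>k<K. if j \<in> {k - \<tau>..<k} then f j * a k else 0)"
    by (rule sum.swap)
  also have "\<dots> \<le> (\<Sum>j<K. f j * (\<Sum>i\<in>{1..\<tau>}. a (j + i)))"
  proof (intro sum_mono)
    fix j
    have "(\<Sum>k<K. if j \<in> {k - \<tau>..<k} then f j * a k else 0)
        = (\<Sum>k\<in>{k\<in>{..<K}. j \<in> {k - \<tau>..<k}}. f j * a k)"
      by (rule sum.inter_filter[symmetric]) simp
    also have "\<dots> \<le> (\<Sum>k\<in>{1 + j..\<tau> + j}. f j * a k)"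
      by (rule sum_mono2) (use assms in auto)
    also have "\<dots> = f j * (\<Sum>i\<in>{1..\<tau>}. a (j + i))"
      unfolding sum.shift_bounds_cl_nat_ivl by (simp add: sum_distrib_left add.commute)
    finally show "(\<Sum>k<K. if j \<in> {k - \<tau>..<k} then f j * a k else 0) \<le> f j * (\<Sum>i\<in>{1..\<tau>}. a (j + i))" .
  qed
  finally show ?thesis .
qed

corollary sum_window_antimono_le:
  fixes a f :: "nat \<Rightarrow> real"
  assumes "\<And>k. a k \<ge> 0" "\<And>k. f k \<ge> 0" "antimono a"
  shows "(\<Sum>k<K. a k * (\<Sum>j\<in>{k - \<tau>..<k}. f j)) \<le> real \<tau> * (\<Sum>j<K. a j * f j)"
proof -
  have "(\<Sum>j<K. f j * (\<Sum>i\<in>{1..\<tau>}. a (j + i))) \<le> (\<Sum>j<K. f j * (\<Sum>i\<in>{1..\<tau>}. a j))"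
    using assms by (intro sum_mono mult_left_mono) (auto simp: antimono_def)
  also have "\<dots> = real \<tau> * (\<Sum>j<K. a j * f j)"
    by (simp add: sum_distrib_left mult_ac)
  finally show ?thesis using sum_window_le[of a f \<tau> K, OF assms(1,2)] by linarith
qed

text \<open>Deterministic Robbins-Siegmund argument: subtracting the errors accumulated so far
  leaves a decreasing sequence that is bounded below, and telescoping bounds the partial sums of
  \<open>p\<close>.\<close>

lemma almost_decreasing_convergent:
  fixes a p q :: "nat \<Rightarrow> real"
  assumes p: "\<And>n. 0 \<le> p n" and q: "\<And>n. 0 \<le> q n" "summable q"
    and a: "\<And>n. l \<le> a n" "\<And>n. a (Suc n) + p n \<le> a n + q n"
  shows "convergent a" "summable p"
proof -
  define c where "c n = a n - (\<Sum>k<n. q k)" for n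
  have "decseq c"
  proof (rule decseq_SucI)
    fix n
    show "c (Suc n) \<le> c n" using a(2)[of n] p[of n] by (simp add: c_def)
  qed
  moreover have "l - suminf q \<le> c n" for n
    using a(1)[of n] sum_le_suminf[OF q(2), of "{..<n}"] q(1) by (simp add: c_def)
  ultimately have "convergent c" using decseq_convergent[of c] by (blast intro: convergentI)
  moreover have "convergent (\<lambda>n. \<Sum>k<n. q k)"
    using q(2) by (simp add: summable_iff_convergent)
  ultimately have "convergent (\<lambda>n. c n + (\<Sum>k<n. q k))" by (rule convergent_add)
  then show "convergent a" by (simp add: c_def)
  have *: "(\<Sum>k<n. p k) + a n \<le> a 0 + (\<Sum>k<n. q k)" for n
  proof (induction n)
    case (Suc n)
    then show ?case using a(2)[of n] by simp
  qed simp
  have "(\<Sum>k<n. p k) \<le> a 0 + suminf q - l" for n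
  proof -
    have "(\<Sum>k<n. q k) \<le> suminf q" using q by (intro sum_le_suminf) auto
    then show ?thesis using a(1)[of n] *[of n] by linarith
  qed
  then show "summable p" using p by (intro summableI_nonneg_bounded)
qed

text \<open>A nonzero limit would make the summable terms dominate a multiple of the harmonic
  series.\<close>

lemma limit_eq_0_of_summable_divide:
  fixes a :: "nat \<Rightarrow> real"
  assumes "a \<longlonglongrightarrow> l" "c > 0" "summable (\<lambda>n. \<bar>a n\<bar> / (real n + c))"
  shows "l = 0"
proof (rule ccontr)
  assume "l \<noteq> 0"
  then have "\<forall>\<^sub>F n in sequentially. \<bar>l\<bar> / 2 < \<bar>a n\<bar>"
    using assms(1) by (intro order_tendstoD(1)[OF tendsto_rabs]) auto
  then have "\<forall>\<^sub>F n in sequentially. norm (inverse (real n)) \<le> (1 + c) * 2 / \<bar>l\<bar> * (\<bar>a n\<bar> / (real n + c))"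
    using eventually_gt_at_top[of 0]
  proof eventually_elim
    case (elim n)
    have "real n + c \<le> (1 + c) * real n" using elim assms(2) by (simp add: algebra_simps)
    then have "inverse (real n) \<le> (1 + c) / (real n + c)"
      using elim assms(2) by (simp add: field_simps)
    also have "\<dots> * 1 \<le> (1 + c) / (real n + c) * (2 / \<bar>l\<bar> * \<bar>a n\<bar>)"
      using elim assms(2) \<open>l \<noteq> 0\<close> by (intro mult_left_mono) (auto simp: field_simps)
    finally show ?case by (simp add: mult_ac)
  qed
  then have "summable (\<lambda>n. inverse (real n))"
    by (rule summable_comparison_test_ev) (intro summable_mult assms(3))
  then show False using not_summable_harmonic[where 'a = real] by simp
qed

lemma summable_window:
  fixes f :: "nat \<Rightarrow> real"
  assumes "\<And>k. 0 \<le> f k" "summable f"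
  shows "summable (\<lambda>k. \<Sum>j\<in>{k - \<tau>..<k}. f j)"
proof (rule summableI_nonneg_bounded)
  fix n
  have "(\<Sum>k<n. \<Sum>j\<in>{k - \<tau>..<k}. f j) \<le> real \<tau> * (\<Sum>j<n. f j)"
    using sum_window_antimono_le[of "\<lambda>_. 1" f \<tau> n] assms by (simp add: antimono_def)
  also have "\<dots> \<le> real \<tau> * suminf f"
    using assms by (intro mult_left_mono sum_le_suminf) auto
  finally show "(\<Sum>k<n. \<Sum>j\<in>{k - \<tau>..<k}. f j) \<le> real \<tau> * suminf f" .
qed (use assms in \<open>auto intro: sum_nonneg\<close>)

section \<open>A single trajectory\<close>

locale afp_path =
  fixes G :: "'a::euclidean_space \<Rightarrow> 'a"
    and \<beta> s \<gamma> \<eta> :: real and \<tau> :: nat and d :: "nat \<Rightarrow> nat" and y0 :: 'a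
    and x y z :: "nat \<Rightarrow> 'a"
  assumes beta_pos: "\<beta> > 0"
    and G_cocoercive: "cocoercive \<beta> G"
    and tau_ge_1: "\<tau> \<ge> 1"
    and delay_bound: "\<And>k. d k \<le> \<tau>"
    and gamma_pos: "0 < \<gamma>" and gamma_le_1: "\<gamma> \<le> 1"
    and s_ge: "s \<ge> 1 + 3 * \<gamma>"
    and eta_pos: "0 < \<eta>" and eta_le: "\<eta> \<le> afp_eta_max \<beta> s \<gamma> \<tau>"
    and scheme: "afp_scheme s (\<lambda>_. \<gamma>) (afp_eta \<eta> s \<tau>) (afp_t s \<tau>) y0
        (\<lambda>k. G (y (k - d k))) x y z"
begin

abbreviation "t \<equiv> afp_t s \<tau>"
abbreviation "T \<equiv> real \<tau>"
abbreviation "g k \<equiv> G (y k)"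
abbreviation "h k \<equiv> G (y (k - d k))"
abbreviation "v k \<equiv> y k - z k"
abbreviation "D k \<equiv> g (Suc k) - g k"
abbreviation "e k \<equiv> h k - g k"
(* The first summand makes the weights c k nonincreasing.  The second one pays for the error
   <e k, g k> when s is close to 1, where the drift s - gamma - 1 cannot. *)
definition b :: real where "b = (s - 1) * (3 * s + T) / (s + T) + T / s"
abbreviation "m k \<equiv> t k + b"
text \<open>By \<open>kappa_eq\<close>, the gap between the weight m_k - 1 that the potential
  \<open>P\<close> puts on s <g_k, v_k> and the weight (1 - s / t_k) m_k that the co-coercivity step
  returns.\<close>

definition \<kappa> :: "nat \<Rightarrow> real" where "\<kappa> k = s - 1 + s * b / t k"
text \<open>The solution of the equation \<open>kappa_c\<close>: the z-step changes |z - xs|^2 by a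
  term with factor 2 \<gamma> \<eta>_k / s, and c_k scales this factor to s \<kappa>_k.\<close>

definition c :: "nat \<Rightarrow> real" where "c k = s\<^sup>2 * (\<kappa> k * (1 - s / t k)) / (\<gamma> * \<eta>)"

section \<open>Bounds on the step size, the shift b and the weights\<close>

lemma s_gt_1: "s > 1" and T_ge_1: "T \<ge> 1"
  using gamma_pos s_ge tau_ge_1 by auto

lemma t_Suc: "t (Suc k) = t k + 1"
  by (simp add: afp_t_def)

lemma t_ge: "t k \<ge> 3 * s + T"
  by (simp add: afp_t_def)

lemma t_mono: "i \<le> j \<Longrightarrow> t i \<le> t j"
  by (simp add: afp_t_def)

lemma t_pos: "t k > 0" "t k - s > 0" and t_gt_3s: "t k > 3 * s"
  using t_ge[of k] s_gt_1 T_ge_1 by linarith+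

text \<open>The step size condition in terms of s - \<gamma> - 1, the quantity that multiplies
  |g_k|^2 in \<open>P_step\<close>. As it is positive, 17 is a floor for the coefficient of
  T.\<close>

lemma eta_T: "\<eta> * (3 + (17 + 7 * (s - \<gamma> - 1)) * T) \<le> 3 * \<beta>"
proof -
  have "0 < 3 + (7 * (1 + s - \<gamma>) + 3) * T"
    using gamma_le_1 s_gt_1 T_ge_1 by (intro add_pos_nonneg mult_nonneg_nonneg) auto
  with eta_le show ?thesis
    by (simp add: afp_eta_max_def pos_le_divide_eq algebra_simps)
qed

lemma eta_T': "\<eta> * T * (17 + 7 * (s - \<gamma> - 1)) \<le> 3 * \<beta>"
  using eta_T eta_pos by (simp add: algebra_simps)

lemma eta_T_le: "\<eta> * T \<le> 3 / 17 * \<beta>"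
proof -
  have "0 \<le> \<eta> * T * (7 * (s - \<gamma> - 1))"
    using eta_pos T_ge_1 s_ge gamma_pos by (intro mult_nonneg_nonneg) auto
  with eta_T'[unfolded distrib_left] have "\<eta> * T * 17 \<le> 3 * \<beta>" by linarith
  then show ?thesis by simp
qed

lemma eta_le_beta: "\<eta> \<le> 3 / 17 * \<beta>"
proof -
  have "\<eta> * 1 \<le> \<eta> * T" using eta_pos T_ge_1 by (intro mult_left_mono) auto
  with eta_T_le show ?thesis by simp
qed

lemma b_monotone: "(s - 1) * (3 * s + T) \<le> b * (s + T)"
proof -
  have "b * (s + T) = (s - 1) * (3 * s + T) + T / s * (s + T)"
    using s_gt_1 T_ge_1 unfolding b_def distrib_right[of _ "T / s"] by simp
  moreover have "0 \<le> T / s * (s + T)" using s_gt_1 T_ge_1 by auto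
  ultimately show ?thesis by linarith
qed

lemma b_ge: "T / s \<le> b"
  using s_gt_1 T_ge_1 by (auto simp: b_def)

lemma b_pos: "b > 0"
proof -
  have "T / s > 0" using s_gt_1 T_ge_1 by simp
  then show ?thesis using b_ge by linarith
qed

text \<open>Since t_k >= 3 s + T, this keeps m_k - 1 between t_k - 1 and 2 (t_k - 1). Enlarging T /
  s to T (3 s + T) / (s + T) puts both summands of b over one denominator, with combined numerator
  (s + T - 1) (3 s + T).\<close>

lemma b_le: "b \<le> 3 * s + T - 1"
proof -
  have "T / s \<le> T * (3 * s + T) / (s + T)"
  proof -
    have "T * (s + T) \<le> T * ((3 * s + T) * s)"
    proof (intro mult_left_mono)
      have "T * 1 \<le> T * s" "s * 1 \<le> s * s" using s_gt_1 T_ge_1 by auto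
      moreover have "0 \<le> s * s" by simp
      moreover have "(3 * s + T) * s = 3 * (s * s) + T * s" by (simp add: algebra_simps)
      ultimately show "s + T \<le> (3 * s + T) * s" by linarith
    qed (use T_ge_1 in auto)
    then show ?thesis using s_gt_1 T_ge_1 by (simp add: field_simps)
  qed
  then have "b \<le> (s - 1) * (3 * s + T) / (s + T) + T * (3 * s + T) / (s + T)"
    by (simp add: b_def)
  also have "\<dots> = (3 * s + T) - (3 * s + T) / (s + T)"
  proof -
    have "s + T \<noteq> 0" using s_gt_1 T_ge_1 by linarith
    then have "q - q / (s + T) = (s + T - 1) * q / (s + T)" for q
      by (simp add: left_diff_distrib diff_divide_distrib)
    moreover have "(s - 1) * q / (s + T) + T * q / (s + T) = (s + T - 1) * q / (s + T)" for q
      by (simp add: algebra_simps flip: add_divide_distrib)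
    ultimately show ?thesis by presburger
  qed
  also have "\<dots> \<le> 3 * s + T - 1"
    using s_gt_1 T_ge_1 by (simp add: field_simps)
  finally show ?thesis .
qed

lemma b_le_t: "b \<le> t k - 1"
  using b_le t_ge[of k] by linarith

lemma kappa_pos: "\<kappa> k > 0"
  using s_gt_1 b_pos t_pos[of k] by (simp add: \<kappa>_def add_pos_nonneg)

lemma kappa_mono: "i \<le> j \<Longrightarrow> \<kappa> j \<le> \<kappa> i"
  using s_gt_1 b_pos t_pos[of i] t_mono[of i j]
  by (auto simp: \<kappa>_def intro!: divide_left_mono mult_pos_pos)

lemma kappa_le: "\<kappa> k \<le> s * m k / t k"
  using t_pos[of k] by (simp add: \<kappa>_def field_simps)

lemma kappa_eq: "\<kappa> k = m k - 1 - (1 - s / t k) * m k"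
  using t_pos[of k] by (simp add: \<kappa>_def field_simps)

lemma kappa_c: "c k * (2 * \<gamma> * afp_eta \<eta> s \<tau> k / s) = s * \<kappa> k"
  using t_pos[of k] gamma_pos eta_pos s_gt_1
  by (simp add: c_def afp_eta_def divide_simps) (simp add: power2_eq_square algebra_simps)

lemma kappa_factor_expand:
  "\<kappa> k * (1 - s / t k) = (s - 1) + s * (1 / t k) * (b - s + 1 - s * b * (1 / t k))"
  using t_pos[of k] by (simp add: \<kappa>_def field_simps power2_eq_square)

text \<open>The worst case is t_0 = 3 s + T, where clearing denominators gives
  \<open>b_monotone\<close>. The factor 2 is for monotonicity: with u = 1 / t_k, the difference of u
  (b - s + 1 - s b u) at u and u' is (u - u') (b - s + 1 - s b (u + u')), and u + u' <= 2 u.\<close>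

lemma b_slack: "2 * s * b * (1 / t k) \<le> b - s + 1"
proof -
  have "2 * s * b * (1 / t k) \<le> 2 * s * b * (1 / (3 * s + T))"
    using s_gt_1 b_pos t_pos[of k] t_ge[of k] T_ge_1
    by (intro mult_left_mono divide_left_mono) auto
  also have "\<dots> \<le> b - s + 1"
    using b_monotone s_gt_1 T_ge_1 by (simp add: field_simps)
  finally show ?thesis .
qed

text \<open>With s - 1 >= 3 \<gamma> it yields c_k >= 3 s^2 / \<eta>, large enough for |z_k - xs|^2
  to absorb the cross term of the Lyapunov function.\<close>

lemma kappa_factor_ge: "s - 1 \<le> \<kappa> k * (1 - s / t k)"
proof -
  have "s * b * (1 / t k) \<le> 2 * s * b * (1 / t k)"
    using s_gt_1 b_pos t_pos[of k] by (intro mult_right_mono) auto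
  then have "s * b * (1 / t k) \<le> b - s + 1" using b_slack[of k] by (rule order_trans)
  then have "0 \<le> b - s + 1 - s * b * (1 / t k)" by (simp only: diff_ge_0_iff_ge)
  then show ?thesis unfolding kappa_factor_expand
    using s_gt_1 t_pos[of k] by auto
qed

lemma kappa_factor_mono: "\<kappa> (Suc k) * (1 - s / t (Suc k)) \<le> \<kappa> k * (1 - s / t k)"
proof -
  define u u' where "u = 1 / t k" and "u' = 1 / t (Suc k)"
  have u: "u' \<le> u" "0 < u'" using t_pos[of k] by (auto simp: u_def u'_def t_Suc frac_le)
  have "s * b * (u + u') \<le> 2 * s * b * u"
    using u s_gt_1 b_pos by (simp add: algebra_simps)
  with b_slack[of k] have "0 \<le> b - s + 1 - s * b * (u + u')" by (simp add: u_def)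
  then have "0 \<le> s * (u - u') * (b - s + 1 - s * b * (u + u'))"
    using u s_gt_1 by auto
  then show ?thesis unfolding kappa_factor_expand u_def[symmetric] u'_def[symmetric]
    by (simp add: algebra_simps)
qed

lemma c_mono: "c (Suc k) \<le> c k"
  unfolding c_def using kappa_factor_mono[of k] gamma_pos eta_pos s_gt_1
  by (intro divide_right_mono mult_left_mono) auto

lemma c_pos: "c k > 0"
proof -
  have "\<kappa> k * (1 - s / t k) > 0" using kappa_factor_ge[of k] s_gt_1 by linarith
  then show ?thesis
    unfolding c_def using gamma_pos eta_pos s_gt_1
    by (intro divide_pos_pos mult_pos_pos[OF _ \<open>\<kappa> k * (1 - s / t k) > 0\<close>] mult_pos_pos[of \<gamma> \<eta>]) auto
qed

section \<open>Recursions for the iterates and the co-coercivity step\<close>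

lemma x_Suc: "x (Suc k) = y k - afp_eta \<eta> s \<tau> k *\<^sub>R h k"
  and z_Suc: "z (Suc k) = z k - (\<gamma> * afp_eta \<eta> s \<tau> k / s) *\<^sub>R h k"
  and y_zero: "y 0 = y0" and z_zero: "z 0 = y0"
  using scheme by (auto simp: afp_scheme_def)

definition \<mu> :: "nat \<Rightarrow> real" where "\<mu> k = \<eta> / 2 + \<gamma> * \<eta> / (2 * (t k - s))"

lemma y_Suc: "y (Suc k) = y k - (s / t k) *\<^sub>R v k - \<mu> k *\<^sub>R h k"
proof -
  have "y (Suc k) = ((t k - s) / t k) *\<^sub>R x (Suc k) + (s / t k) *\<^sub>R z (Suc k)"
    using scheme by (auto simp: afp_scheme_def)
  also have "\<dots> = ((t k - s) / t k) *\<^sub>R y k + (s / t k) *\<^sub>R z k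
     - ((t k - s) / t k * afp_eta \<eta> s \<tau> k + s / t k * (\<gamma> * afp_eta \<eta> s \<tau> k / s)) *\<^sub>R h k"
    unfolding x_Suc z_Suc scaleR_diff_right scaleR_add_left scaleR_scaleR by simp
  also have "(t k - s) / t k * afp_eta \<eta> s \<tau> k + s / t k * (\<gamma> * afp_eta \<eta> s \<tau> k / s) = \<mu> k"
  proof -
    have "q / p * (\<eta> * p / (2 * q)) + s / p * (\<gamma> * (\<eta> * p / (2 * q)) / s) = \<eta> / 2 + \<gamma> * \<eta> / (2 * q)"
      if "q > 0" "p > 0" for p q
      using that s_gt_1 by (simp add: field_simps)
    from this[of "t k - s" "t k"] t_pos[of k] show ?thesis
      by (simp add: \<mu>_def afp_eta_def)
  qed
  also have "(t k - s) / t k = 1 - s / t k"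
    using t_pos[of k] by (simp add: field_simps)
  finally show ?thesis by (simp add: scaleR_diff_left scaleR_diff_right)
qed

lemma v_zero: "v 0 = 0" by (simp add: y_zero z_zero)

text \<open>The variable step \<eta>_k is tuned so that the coefficient of h_k is the same for all
  k; this makes v a plain contraction driven by h.\<close>

lemma v_Suc: "v (Suc k) = (1 - s / t k) *\<^sub>R v k - ((1 - \<gamma> / s) * \<eta> / 2) *\<^sub>R h k"
proof -
  have "(1 - \<gamma> / s) * \<eta> / 2 = \<mu> k - \<gamma> * afp_eta \<eta> s \<tau> k / s"
  proof -
    have "\<eta> / 2 + \<gamma> * \<eta> / (2 * q) - \<gamma> * (\<eta> * (q + s) / (2 * q)) / s = (1 - \<gamma> / s) * \<eta> / 2"
      if "q > 0" for q
      using that s_gt_1 by (simp add: field_simps)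
    from this[of "t k - s"] t_pos[of k] show ?thesis
      by (simp add: \<mu>_def afp_eta_def)
  qed
  then show ?thesis unfolding y_Suc z_Suc by (simp only: scaleR_diff_left) simp
qed

lemma cocoercive_step:
  "\<beta> * (norm (D k))\<^sup>2 \<le> D k \<bullet> (y (Suc k) - y k)"
  using G_cocoercive by (simp add: cocoercive_def)

text \<open>The same displacement in two scalings: the first shows v_k and is paired with g_k, the
  second shows v_{k+1} and is paired with g_{k+1}. Each g then meets the v of its own index, so that
  the inner products can telescope.\<close>

lemma step_y:
  "t k *\<^sub>R (y (Suc k) - y k) = - (s *\<^sub>R v k) - (t k * \<mu> k) *\<^sub>R h k"
  "(t k - s) *\<^sub>R (y (Suc k) - y k) = - (s *\<^sub>R v (Suc k)) - (\<eta> * t k / 2) *\<^sub>R h k"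
proof -
  show "t k *\<^sub>R (y (Suc k) - y k) = - (s *\<^sub>R v k) - (t k * \<mu> k) *\<^sub>R h k"
    using t_pos[of k] by (simp add: y_Suc scaleR_diff_right)
  have 1: "(t k - s) * (s / t k) = s * (1 - s / t k)"
    using t_pos[of k] by (simp add: field_simps)
  have 2: "(t k - s) * \<mu> k = \<eta> * t k / 2 - s * ((1 - \<gamma> / s) * \<eta> / 2)"
    using t_pos[of k] s_gt_1 by (simp add: \<mu>_def divide_simps) (simp add: algebra_simps)
  have "(t k - s) *\<^sub>R (y (Suc k) - y k) = - (((t k - s) * (s / t k)) *\<^sub>R v k) - ((t k - s) * \<mu> k) *\<^sub>R h k"
    by (simp add: y_Suc scaleR_diff_right)
  also have "\<dots> = - (s *\<^sub>R v (Suc k)) - (\<eta> * t k / 2) *\<^sub>R h k"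
  proof -
    have "s *\<^sub>R v (Suc k) = (s * (1 - s / t k)) *\<^sub>R v k - (s * ((1 - \<gamma> / s) * \<eta> / 2)) *\<^sub>R h k"
      by (subst v_Suc, subst scaleR_diff_right, simp only: scaleR_scaleR)
    then show ?thesis unfolding 1 2 scaleR_diff_left[of "\<eta> * t k / 2"] by simp
  qed
  finally show "(t k - s) *\<^sub>R (y (Suc k) - y k) = - (s *\<^sub>R v (Suc k)) - (\<eta> * t k / 2) *\<^sub>R h k" .
qed

lemma cocoercive_descent:
  "\<beta> * m k * (t k - s) * (norm (D k))\<^sup>2 \<le>
     - s * m k * (g (Suc k) \<bullet> v (Suc k)) - \<eta> * t k * m k / 2 * (g (Suc k) \<bullet> h k)
     + s * ((1 - s / t k) * m k) * (g k \<bullet> v k)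
     + \<eta> * m k / 2 * (t k - s + \<gamma>) * (g k \<bullet> h k)"
proof -
  have m: "m k > 0" using t_pos[of k] b_pos by simp
  define r where "r = 1 - s / t k"
  have r: "t k - s = r * t k" using t_pos[of k] by (simp add: r_def field_simps)
  have "m k * (t k - s) * (\<beta> * (norm (D k))\<^sup>2) \<le> m k * (t k - s) * (D k \<bullet> (y (Suc k) - y k))"
    using cocoercive_step[of k] m t_pos[of k] by (intro mult_left_mono) auto
  also have "\<dots> = m k * (g (Suc k) \<bullet> ((t k - s) *\<^sub>R (y (Suc k) - y k)))
      - m k * r * (g k \<bullet> (t k *\<^sub>R (y (Suc k) - y k)))"
    unfolding inner_diff_left inner_scaleR_right r by (simp add: right_diff_distrib)
  also have "\<dots> = m k * (- s * (g (Suc k) \<bullet> v (Suc k)) - \<eta> * t k / 2 * (g (Suc k) \<bullet> h k))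
      - m k * r * (- s * (g k \<bullet> v k) - t k * \<mu> k * (g k \<bullet> h k))"
    unfolding step_y inner_diff_right inner_minus_right inner_scaleR_right by simp
  also have "\<dots> = - s * m k * (g (Suc k) \<bullet> v (Suc k)) - \<eta> * t k * m k / 2 * (g (Suc k) \<bullet> h k)
     + s * (r * m k) * (g k \<bullet> v k)
     + m k * ((t k - s) * \<mu> k) * (g k \<bullet> h k)"
    unfolding r right_diff_distrib by simp
  also have "(t k - s) * \<mu> k = \<eta> / 2 * (t k - s + \<gamma>)"
    using t_pos[of k] by (simp add: \<mu>_def divide_simps) (simp add: algebra_simps)
  finally show ?thesis by (simp add: r_def mult_ac)
qed


subsection \<open>Bounds on the delay errors\<close>

definition S :: "nat \<Rightarrow> real" where "S k = (\<Sum>j\<in>{k - \<tau>..<k}. (norm (D j))\<^sup>2)"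

lemma S_nonneg: "S k \<ge> 0" by (simp add: S_def sum_nonneg)

lemma norm_e_le: "(norm (e k))\<^sup>2 \<le> T * S k"
proof -
  have "g k - h k = (\<Sum>j\<in>{k - d k..<k}. D j)"
    using sum_Suc_diff'[of "k - d k" k g] by simp
  then have "(norm (e k))\<^sup>2 = (norm (\<Sum>j\<in>{k - d k..<k}. D j))\<^sup>2"
    by (simp add: norm_minus_commute)
  also have "\<dots> \<le> real (card {k - d k..<k}) * (\<Sum>j\<in>{k - d k..<k}. (norm (D j))\<^sup>2)"
    by (rule norm_sum_squared_le)
  also have "\<dots> \<le> T * S k"
    unfolding S_def using delay_bound[of k]
    by (intro mult_mono sum_mono2 sum_nonneg) auto
  finally show ?thesis .
qed

lemma m_pos: "m k > 0" and m_le: "m k \<le> 2 * t k"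
  using t_pos[of k] b_pos b_le_t[of k] by auto

abbreviation "sg \<equiv> s - \<gamma> - 1"

lemma sg_ge: "sg \<ge> 2 * \<gamma>" "sg > 0" "s \<le> 1 + 3 / 2 * sg"
proof -
  show "sg \<ge> 2 * \<gamma>" "sg > 0" using s_ge gamma_pos by simp_all
  have "3 / 2 * sg = 3 / 2 * s - 3 / 2 * \<gamma> - 3 / 2" by (simp add: field_simps)
  then show "s \<le> 1 + 3 / 2 * sg" using s_ge by linarith
qed

text \<open>The parameter T / 2 balances the costs: \<open>norm_e_le\<close> contributes one T, and
  summing S later contributes another, so that both error terms are of order \<eta> T times weighted
  |D|^2.\<close>

lemma young_eD:
  "\<eta> / 2 * t k * m k * (e k \<bullet> D k) \<ge> - (\<eta> * T / 4) * (m k * t k * (norm (D k))\<^sup>2) - \<eta> / 4 * (m k * t k * S k)"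
proof -
  have "(norm (e k))\<^sup>2 / (2 * T) \<le> S k / 2"
    using norm_e_le[of k] T_ge_1 by (simp add: field_simps)
  moreover have "D k \<bullet> e k \<ge> - (T / 2 * (norm (D k))\<^sup>2 + (norm (e k))\<^sup>2 / (4 * (T / 2)))"
    using T_ge_1 by (intro inner_Young) auto
  ultimately have "e k \<bullet> D k \<ge> - (T / 2 * (norm (D k))\<^sup>2) - S k / 2"
    by (simp add: inner_commute)
  then have "\<eta> / 2 * t k * m k * (e k \<bullet> D k) \<ge> \<eta> / 2 * t k * m k * (- (T / 2 * (norm (D k))\<^sup>2) - S k / 2)"
    using eta_pos t_pos[of k] m_pos[of k] by (intro mult_left_mono) auto
  then show ?thesis by (simp add: right_diff_distrib mult_ac)
qed

text \<open>The scalar inequality behind \<open>young_eg\<close>. For large \<open>sg\<close> the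
  quadratic left side is compensated by the part 7 \<open>sg\<close> of the step size bound; for
  \<open>sg\<close> near 0 the term 1 / (4 s), supplied by the summand T / s of b, has to carry
  it.\<close>

lemma eg_weight: "\<eta> * T * (1 + sg)\<^sup>2 \<le> 4 / 5 * \<beta> * (3 / 4 * sg + 1 / (4 * s))"
proof -
  define r where "r = 1 / s"
  have poly: "3 * (1 + w)\<^sup>2 \<le> (17 + 7 * w) * (4 / 5 * (3 / 4 * w + r / 4))"
    if "0 \<le> w" "1 - 3 / 2 * w \<le> r" "0 \<le> r" for w
  proof -
    \<comment> \<open>Inserting r >= 1 - 3/2 w into 17 r + 21 w + 6 w^2 leaves 17 - 9/2 w + 6 w^2,
      whose minimum, at w = 3/8, exceeds 15.\<close>
    have "0 \<le> 6 * (w - 3 / 8)\<^sup>2" by simp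
    then have "15 \<le> 17 * r + 21 * w + 6 * w\<^sup>2"
      using that by (simp add: power2_eq_square algebra_simps)
    moreover have "0 \<le> 7 * w * r" using that by simp
    ultimately have "15 + 30 * w + 15 * w\<^sup>2 \<le> 51 * w + 17 * r + 21 * w\<^sup>2 + 7 * w * r"
      by linarith
    also have "\<dots> = 5 * ((17 + 7 * w) * (4 / 5 * (3 / 4 * w + r / 4)))"
      by (simp add: power2_eq_square algebra_simps)
    finally show ?thesis by (simp add: power2_eq_square algebra_simps)
  qed
  \<comment> \<open>The tangent of the convex function 1 / s at s = 1; with s <= 1 + 3/2
    \<open>sg\<close> it gives the hypothesis on r in \<open>poly\<close>.\<close>
  have "2 - s \<le> r" using s_gt_1 sum_squares_bound[of s 1] by (simp add: r_def field_simps power2_eq_square)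
  with sg_ge have *: "3 * (1 + sg)\<^sup>2 \<le> (17 + 7 * sg) * (4 / 5 * (3 / 4 * sg + r / 4))"
    using s_gt_1 by (intro poly) (auto simp: r_def)
  have pos: "17 + 7 * sg > 0" using sg_ge by simp
  have "\<eta> * T * (1 + sg)\<^sup>2 * (17 + 7 * sg) \<le> 3 * \<beta> * (1 + sg)\<^sup>2"
    using mult_right_mono[OF eta_T', of "(1 + sg)\<^sup>2"] by (simp add: mult_ac)
  also have "\<dots> \<le> \<beta> * ((17 + 7 * sg) * (4 / 5 * (3 / 4 * sg + r / 4)))"
    using mult_left_mono[OF *, of \<beta>] beta_pos by (simp add: mult_ac)
  finally have "\<eta> * T * (1 + sg)\<^sup>2 * (17 + 7 * sg) \<le> \<beta> * (4 / 5 * (3 / 4 * sg + r / 4)) * (17 + 7 * sg)"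
    by (simp only: mult_ac)
  then have "\<eta> * T * (1 + sg)\<^sup>2 \<le> \<beta> * (4 / 5 * (3 / 4 * sg + r / 4))"
    using pos by (rule mult_right_le_imp_le)
  then show ?thesis by (simp add: r_def mult_ac)
qed

lemma young_eg:
  "\<eta> / 2 * m k * (1 + sg) * (e k \<bullet> g k)
    \<ge> - (\<eta> / 2 * (3 / 4 * sg * m k + b / 2)) * (norm (g k))\<^sup>2 - \<beta> / (10 * T) * (m k * t k * S k)"
proof -
  \<comment> \<open>Chosen so that m_k A = 3/4 \<open>sg\<close> m_k + b / 2: of the gain (\<eta>/4)
    (2 m_k \<open>sg\<close> + b + 1) |g_k|^2 this spends three quarters of the \<open>sg\<close>
    part and all of the b part.\<close>
  define A where "A = 3 / 4 * sg + b / (2 * m k)"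
  have A: "A > 0" using sg_ge b_pos m_pos[of k] by (simp add: A_def add_pos_pos)
  have tA: "T * (3 / 4 * sg + 1 / (4 * s)) \<le> t k * A"
  proof -
    have "T * (3 / 4 * sg) \<le> t k * (3 / 4 * sg)"
      using t_ge[of k] s_gt_1 sg_ge by (intro mult_right_mono) auto
    moreover have "T / (4 * s) \<le> t k * (b / (2 * m k))"
    proof -
      have "T / (4 * s) \<le> b / 4" using b_ge by simp
      also have "b * m k \<le> b * (2 * t k)" using b_pos m_le[of k] by (intro mult_left_mono) auto
      then have "b / 4 \<le> t k * (b / (2 * m k))" using m_pos[of k] by (simp add: field_simps)
      finally show ?thesis .
    qed
    ultimately show ?thesis by (simp add: A_def distrib_left)
  qed
  have "\<eta> * T * (1 + sg)\<^sup>2 * T \<le> 4 / 5 * \<beta> * (T * (3 / 4 * sg + 1 / (4 * s)))"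
    using mult_right_mono[OF eg_weight, of T] by (simp add: mult_ac)
  also have "\<dots> \<le> 4 / 5 * \<beta> * (t k * A)"
    using tA beta_pos by (intro mult_left_mono) auto
  finally have w: "\<eta> * T * (1 + sg)\<^sup>2 * T \<le> 4 / 5 * \<beta> * (t k * A)" .
  have w': "\<eta> / 2 * ((1 + sg)\<^sup>2 * T / (4 * A)) \<le> \<beta> / (10 * T) * t k"
    using w A T_ge_1 by (simp add: field_simps)
  have "g k \<bullet> ((1 + sg) *\<^sub>R e k) \<ge> - (A * (norm (g k))\<^sup>2 + (norm ((1 + sg) *\<^sub>R e k))\<^sup>2 / (4 * A))"
    using A by (rule inner_Young)
  also have "(norm ((1 + sg) *\<^sub>R e k))\<^sup>2 = (1 + sg)\<^sup>2 * (norm (e k))\<^sup>2"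
    by (simp add: power_mult_distrib)
  finally have "(1 + sg) * (e k \<bullet> g k) \<ge> - (A * (norm (g k))\<^sup>2 + (1 + sg)\<^sup>2 * (norm (e k))\<^sup>2 / (4 * A))"
    by (simp add: inner_commute)
  moreover have "(1 + sg)\<^sup>2 * (norm (e k))\<^sup>2 / (4 * A) \<le> (1 + sg)\<^sup>2 * (T * S k) / (4 * A)"
    using norm_e_le[of k] A by (intro divide_right_mono mult_left_mono) auto
  ultimately have "(1 + sg) * (e k \<bullet> g k) \<ge> - (A * (norm (g k))\<^sup>2) - (1 + sg)\<^sup>2 * T / (4 * A) * S k"
    by simp
  then have "(\<eta> / 2 * m k) * ((1 + sg) * (e k \<bullet> g k)) \<ge> (\<eta> / 2 * m k) * (- (A * (norm (g k))\<^sup>2) - (1 + sg)\<^sup>2 * T / (4 * A) * S k)"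
    using eta_pos m_pos[of k] by (intro mult_left_mono) auto
  moreover have "(\<eta> / 2 * m k) * (- (A * (norm (g k))\<^sup>2) - (1 + sg)\<^sup>2 * T / (4 * A) * S k)
     = - (\<eta> / 2 * (m k * A)) * (norm (g k))\<^sup>2 - (\<eta> / 2 * ((1 + sg)\<^sup>2 * T / (4 * A))) * (m k * S k)"
    by (simp add: right_diff_distrib mult_ac)
  moreover have mA: "m k * A = 3 / 4 * sg * m k + b / 2"
    using m_pos[of k] by (simp add: A_def field_simps)
  moreover have "(\<eta> / 2 * ((1 + sg)\<^sup>2 * T / (4 * A))) * (m k * S k) \<le> \<beta> / (10 * T) * t k * (m k * S k)"
    using w' m_pos[of k] S_nonneg[of k] by (intro mult_right_mono) auto
  moreover have "\<eta> / 2 * m k * (1 + sg) * (e k \<bullet> g k) = (\<eta> / 2 * m k) * ((1 + sg) * (e k \<bullet> g k))"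
    by (simp only: mult.assoc)
  moreover have "\<beta> / (10 * T) * (m k * t k * S k) = \<beta> / (10 * T) * t k * (m k * S k)"
    by (simp only: mult_ac)
  ultimately show ?thesis unfolding mA by linarith
qed

lemma young_ev:
  "- (s * \<kappa> k * (e k \<bullet> v k))
    \<ge> - \<beta> / (20 * T) * (m k * t k * S k) - 5 * s ^ 3 * T\<^sup>2 / \<beta> * (\<kappa> k * ((norm (v k))\<^sup>2 / (t k)\<^sup>2))"
proof -
  \<comment> \<open>The Young parameter for which |e_k|^2 <= T S_k produces exactly the coefficient
    \<beta> / (20 T) of m_k t_k S_k.\<close>
  define X where "X = \<beta> * m k * t k / (20 * s * \<kappa> k * T\<^sup>2)"
  have pos: "s > 0" "\<kappa> k > 0" "T > 0" "t k > 0" "m k > 0" "X > 0"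
    using s_gt_1 kappa_pos[of k] T_ge_1 t_pos[of k] m_pos[of k] beta_pos by (auto simp: X_def)
  have "(- e k) \<bullet> v k \<ge> - (X * (norm (- e k))\<^sup>2 + (norm (v k))\<^sup>2 / (4 * X))"
    using pos by (intro inner_Young) auto
  moreover have "X * (norm (e k))\<^sup>2 \<le> X * (T * S k)"
    using norm_e_le[of k] pos by (intro mult_left_mono) auto
  ultimately have "- (e k \<bullet> v k) \<ge> - (X * (T * S k)) - (norm (v k))\<^sup>2 / (4 * X)"
    by (simp only: norm_minus_cancel inner_minus_left)
  then have "s * \<kappa> k * (- (e k \<bullet> v k)) \<ge> s * \<kappa> k * (- (X * (T * S k)) - (norm (v k))\<^sup>2 / (4 * X))"
    using pos by (intro mult_left_mono) auto
  moreover have "s * \<kappa> k * (- (X * (T * S k)) - (norm (v k))\<^sup>2 / (4 * X))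
     = - (s * \<kappa> k * X * T) * S k - (norm (v k))\<^sup>2 * (s * \<kappa> k / (4 * X))"
    by (simp add: right_diff_distrib mult_ac)
  moreover have XT: "s * \<kappa> k * X * T = \<beta> / (20 * T) * (m k * t k)"
    using pos by (simp add: X_def field_simps power2_eq_square)
  moreover have "s * \<kappa> k / (4 * X) \<le> 5 * s ^ 3 * T\<^sup>2 / \<beta> * (\<kappa> k / (t k)\<^sup>2)"
  proof -
    have "s * \<kappa> k / (4 * X) = 5 * s\<^sup>2 * T\<^sup>2 * \<kappa> k / (\<beta> * m k * t k) * \<kappa> k"
      using pos beta_pos by (simp add: X_def field_simps power2_eq_square)
    \<comment> \<open>One of the two factors \<kappa>_k is traded for s m_k / t_k, which cancels m_k
      and leaves \<kappa>_k |v_k|^2 / t_k^2, the quantity whose sum the recursion of v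
      controls.\<close>
    also have "\<dots> \<le> 5 * s\<^sup>2 * T\<^sup>2 * \<kappa> k / (\<beta> * m k * t k) * (s * m k / t k)"
      using pos beta_pos kappa_le[of k] by (intro mult_left_mono) auto
    also have "\<dots> = 5 * s ^ 3 * T\<^sup>2 / \<beta> * (\<kappa> k / (t k)\<^sup>2)"
      using pos beta_pos by (simp add: divide_simps power2_eq_square power3_eq_cube)
    finally show ?thesis .
  qed
  then have "(norm (v k))\<^sup>2 * (s * \<kappa> k / (4 * X)) \<le> (norm (v k))\<^sup>2 * (5 * s ^ 3 * T\<^sup>2 / \<beta> * (\<kappa> k / (t k)\<^sup>2))"
    by (intro mult_left_mono) auto
  moreover have "s * \<kappa> k * (- (e k \<bullet> v k)) = - (s * \<kappa> k * (e k \<bullet> v k))" by simp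
  moreover have "- \<beta> / (20 * T) * (m k * t k * S k) = - (\<beta> / (20 * T) * (m k * t k)) * S k" by simp
  moreover have "5 * s ^ 3 * T\<^sup>2 / \<beta> * (\<kappa> k * ((norm (v k))\<^sup>2 / (t k)\<^sup>2))
      = (norm (v k))\<^sup>2 * (5 * s ^ 3 * T\<^sup>2 / \<beta> * (\<kappa> k / (t k)\<^sup>2))" by (simp add: mult_ac)
  ultimately show ?thesis unfolding XT by linarith
qed

lemma mu_pos: "\<mu> k > 0" and mu_le: "\<mu> k \<le> 3 / 5 * \<eta>"
proof -
  show "\<mu> k > 0" using eta_pos gamma_pos t_pos[of k] by (simp add: \<mu>_def add_pos_pos)
  have "t k - s \<ge> 8 * \<gamma>" using t_gt_3s[of k] s_ge gamma_le_1 by linarith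
  then have "\<eta> * (8 * \<gamma>) \<le> \<eta> * (t k - s)" using eta_pos by (intro mult_left_mono) auto
  then have "\<gamma> * \<eta> / (2 * (t k - s)) \<le> \<eta> / 16"
    using t_pos[of k] by (simp add: field_simps)
  then show "\<mu> k \<le> 3 / 5 * \<eta>" using eta_pos by (simp add: \<mu>_def)
qed

lemma young_delay:
  "h k \<bullet> (y k - y (k - d k)) \<ge> - (31 / 100 * \<beta>) * (norm (h k))\<^sup>2
     - 3 / 10 * \<eta> * (\<Sum>j\<in>{k - \<tau>..<k}. (norm (h j))\<^sup>2)
     - T * s\<^sup>2 / \<beta> * (\<Sum>j\<in>{k - \<tau>..<k}. (norm (v j))\<^sup>2 / (t j)\<^sup>2)"
proof -
  \<comment> \<open>The cost in |h_k|^2 per step of the drift: \<beta> / (4 T) for the v part, so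
    that T steps cost \<beta> / 4, and half of the bound 3/5 \<eta> on \<mu> for the h part.\<close>
  define q where "q = \<beta> / (4 * T) + 3 / 10 * \<eta>"
  have T: "T > 0" "\<beta> > 0" "\<eta> > 0" using T_ge_1 beta_pos eta_pos by auto
  have q: "q \<ge> 0" using T by (simp add: q_def)
  define F where "F j = 3 / 10 * \<eta> * (norm (h j))\<^sup>2 + T * s\<^sup>2 / \<beta> * ((norm (v j))\<^sup>2 / (t j)\<^sup>2)" for j
  have F: "F j \<ge> 0" for j unfolding F_def using T by (intro add_nonneg_nonneg mult_nonneg_nonneg) auto
  have step: "h k \<bullet> (y (Suc j) - y j) \<ge> - (q * (norm (h k))\<^sup>2 + F j)" for j
  proof -
    have 1: "h k \<bullet> (- ((s / t j) *\<^sub>R v j)) \<ge> - (\<beta> / (4 * T) * (norm (h k))\<^sup>2 + (norm (- ((s / t j) *\<^sub>R v j)))\<^sup>2 / (4 * (\<beta> / (4 * T))))"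
      using T by (intro inner_Young) auto
    have 2: "(norm (- ((s / t j) *\<^sub>R v j)))\<^sup>2 / (4 * (\<beta> / (4 * T))) = T * s\<^sup>2 / \<beta> * ((norm (v j))\<^sup>2 / (t j)\<^sup>2)"
      using T by (simp add: power_mult_distrib power_divide mult_ac)
    have "- h k \<bullet> h j \<ge> - (1 / 2 * (norm (- h k))\<^sup>2 + (norm (h j))\<^sup>2 / (4 * (1 / 2)))"
      by (intro inner_Young) auto
    then have "- h k \<bullet> h j \<ge> - (((norm (h k))\<^sup>2 + (norm (h j))\<^sup>2) / 2)" by simp
    then have "\<mu> j * (- h k \<bullet> h j) \<ge> \<mu> j * - (((norm (h k))\<^sup>2 + (norm (h j))\<^sup>2) / 2)"
      using mu_pos[of j] by (intro mult_left_mono) auto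
    moreover have "\<mu> j * (((norm (h k))\<^sup>2 + (norm (h j))\<^sup>2) / 2) \<le> 3 / 5 * \<eta> * (((norm (h k))\<^sup>2 + (norm (h j))\<^sup>2) / 2)"
      using mu_le[of j] by (intro mult_right_mono) auto
    moreover have "y (Suc j) - y j = - ((s / t j) *\<^sub>R v j) - \<mu> j *\<^sub>R h j" by (simp add: y_Suc)
    then have "h k \<bullet> (y (Suc j) - y j) = h k \<bullet> (- ((s / t j) *\<^sub>R v j)) + \<mu> j * (- h k \<bullet> h j)"
      by (simp only: inner_diff_right inner_scaleR_right inner_minus_left)
    ultimately show ?thesis using 1 unfolding 2 by (simp add: q_def F_def algebra_simps)
  qed
  have "h k \<bullet> (y k - y (k - d k)) = (\<Sum>j\<in>{k - d k..<k}. h k \<bullet> (y (Suc j) - y j))"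
    using sum_Suc_diff'[of "k - d k" k y] by (simp flip: inner_sum_right)
  also have "\<dots> \<ge> (\<Sum>j\<in>{k - d k..<k}. - (q * (norm (h k))\<^sup>2 + F j))"
    using step by (rule sum_mono)
  also have "(\<Sum>j\<in>{k - d k..<k}. - (q * (norm (h k))\<^sup>2 + F j))
     = - (real (card {k - d k..<k}) * (q * (norm (h k))\<^sup>2) + (\<Sum>j\<in>{k - d k..<k}. F j))"
    by (simp only: sum_negf sum.distrib sum_constant)
  finally have "h k \<bullet> (y k - y (k - d k)) \<ge> - (real (card {k - d k..<k}) * (q * (norm (h k))\<^sup>2) + (\<Sum>j\<in>{k - d k..<k}. F j))" .
  moreover have "real (card {k - d k..<k}) * (q * (norm (h k))\<^sup>2) \<le> T * (q * (norm (h k))\<^sup>2)"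
    using delay_bound[of k] q by (intro mult_right_mono) auto
  \<comment> \<open>Indeed 1/4 + (3/10) (3/17) < 31/100.\<close>
  moreover have "T * q \<le> 31 / 100 * \<beta>" using eta_T_le T by (simp add: q_def field_simps)
  then have "T * q * (norm (h k))\<^sup>2 \<le> 31 / 100 * \<beta> * (norm (h k))\<^sup>2" by (rule mult_right_mono) simp
  moreover have "(\<Sum>j\<in>{k - d k..<k}. F j) \<le> (\<Sum>j\<in>{k - \<tau>..<k}. F j)"
    using F delay_bound[of k] by (intro sum_mono2) auto
  moreover have "(\<Sum>j\<in>{k - \<tau>..<k}. F j) = 3 / 10 * \<eta> * (\<Sum>j\<in>{k - \<tau>..<k}. (norm (h j))\<^sup>2)
     + T * s\<^sup>2 / \<beta> * (\<Sum>j\<in>{k - \<tau>..<k}. (norm (v j))\<^sup>2 / (t j)\<^sup>2)"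
    by (simp add: F_def sum.distrib sum_distrib_left)
  ultimately show ?thesis by (simp add: mult_ac)
qed


subsection \<open>The Lyapunov inequality\<close>

text \<open>The offsets -1 compensate t_{k+1} = t_k + 1: P at k + 1 carries the weights t_k m_k and
  m_k that the co-coercivity step at k puts on g_{k+1}.\<close>

definition P :: "nat \<Rightarrow> real" where
  "P k = \<eta> / 4 * (t k - 1) * (m k - 1) * (norm (g k))\<^sup>2 + s * (m k - 1) * (g k \<bullet> v k)"

definition Ly :: "'a \<Rightarrow> nat \<Rightarrow> real" where
  "Ly xs k = P k + c k * (norm (z k - xs))\<^sup>2"

lemma afp_eta_bounds: "afp_eta \<eta> s \<tau> k \<ge> 0" "afp_eta \<eta> s \<tau> k \<le> 3 / 4 * \<eta>"
proof -
  have "t k / (t k - s) \<le> 3 / 2" using t_pos[of k] t_gt_3s[of k] by (simp add: field_simps)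
  then have "\<eta> / 2 * (t k / (t k - s)) \<le> \<eta> / 2 * (3 / 2)" using eta_pos by (intro mult_left_mono) auto
  then show "afp_eta \<eta> s \<tau> k \<le> 3 / 4 * \<eta>" by (simp add: afp_eta_def)
  show "afp_eta \<eta> s \<tau> k \<ge> 0" using eta_pos t_pos[of k] by (simp add: afp_eta_def)
qed

lemma z_step_le: "\<gamma> * afp_eta \<eta> s \<tau> k / s \<le> \<beta> / 25"
proof -
  have "\<gamma> / s \<le> 1 / 4" using s_ge gamma_le_1 s_gt_1 by (simp add: field_simps)
  then have "\<gamma> / s * afp_eta \<eta> s \<tau> k \<le> 1 / 4 * (3 / 4 * \<eta>)"
    using afp_eta_bounds[of k] by (intro mult_mono) auto
  with eta_le_beta beta_pos show ?thesis by simp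
qed

lemma cocoercive_zer: "xs \<in> zer G \<Longrightarrow> \<beta> * (norm (G w))\<^sup>2 \<le> G w \<bullet> (w - xs)"
proof -
  assume "xs \<in> zer G"
  moreover have "\<beta> * (norm (G w - G xs))\<^sup>2 \<le> (G w - G xs) \<bullet> (w - xs)"
    using G_cocoercive by (simp add: cocoercive_def)
  ultimately show ?thesis by (simp add: zer_def)
qed

lemma z_descent:
  "(norm (z k - xs))\<^sup>2 - (norm (z (Suc k) - xs))\<^sup>2
    = \<gamma> * afp_eta \<eta> s \<tau> k / s * (2 * (h k \<bullet> (z k - xs)) - \<gamma> * afp_eta \<eta> s \<tau> k / s * (norm (h k))\<^sup>2)"
proof -
  define q where "q = \<gamma> * afp_eta \<eta> s \<tau> k / s"
  have "z (Suc k) - xs = (z k - xs) - q *\<^sub>R h k" by (simp add: z_Suc q_def)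
  moreover have "(norm u)\<^sup>2 - (norm (u - q *\<^sub>R w))\<^sup>2 = q * (2 * (w \<bullet> u) - q * (norm w)\<^sup>2)" for u w :: 'a
    unfolding power2_norm_eq_inner
    by (simp add: inner_diff_left inner_diff_right inner_commute[of u w] algebra_simps)
  ultimately show ?thesis unfolding q_def[symmetric] by (simp only:)
qed

text \<open>h_k is the value of G at the delayed point, so co-coercivity gives |h_k|^2 only there;
  the other two terms are the price of moving from that point to y_k and on to z_k.\<close>

lemma h_inner_z:
  assumes "xs \<in> zer G"
  shows "h k \<bullet> (z k - xs) \<ge> \<beta> * (norm (h k))\<^sup>2 + h k \<bullet> (y k - y (k - d k)) - h k \<bullet> v k"
proof -
  have "h k \<bullet> (z k - xs) = h k \<bullet> (y (k - d k) - xs) + h k \<bullet> (y k - y (k - d k)) - h k \<bullet> v k"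
    by (simp add: inner_diff_right)
  with cocoercive_zer[OF assms, of "y (k - d k)"] show ?thesis by simp
qed

lemma P_step:
  "P k - P (Suc k) \<ge>
    \<beta> * m k * (t k - s) * (norm (D k))\<^sup>2 - \<eta> / 4 * (t k * m k) * (norm (D k))\<^sup>2
    + \<eta> / 4 * (2 * m k * sg + b + 1) * (norm (g k))\<^sup>2
    + \<eta> / 2 * t k * m k * (e k \<bullet> D k) + \<eta> / 2 * m k * (1 + sg) * (e k \<bullet> g k)
    + s * \<kappa> k * (g k \<bullet> v k)"
proof -
  define gg DD ge eD where "gg = (norm (g k))\<^sup>2" and "DD = (norm (D k))\<^sup>2"
    and "ge = e k \<bullet> g k" and "eD = e k \<bullet> D k"
  define g1 where "g1 = (norm (g (Suc k)))\<^sup>2"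
  have gh: "g k \<bullet> h k = gg + ge"
    by (simp add: gg_def ge_def power2_norm_eq_inner inner_diff_left inner_commute[of "g k" "h k"])
  \<comment> \<open>Polarisation: the mixed product turns into the square |g_{k+1}|^2 needed for P
    at k + 1, at the price of (\<eta>/4) t_k m_k |D_k|^2.\<close>
  have g1h: "g (Suc k) \<bullet> h k = (g1 + gg - DD) / 2 + ge + eD"
    by (simp add: gg_def ge_def eD_def g1_def DD_def power2_norm_eq_inner inner_diff_left inner_diff_right inner_commute)
  define E E1 where "E = g k \<bullet> v k" and "E1 = g (Suc k) \<bullet> v (Suc k)"
  define r where "r = 1 - s / t k"
  have kr: "r * m k = m k - 1 - \<kappa> k" using kappa_eq[of k] by (simp add: r_def)
  have "\<beta> * m k * (t k - s) * DD \<le>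
     - s * m k * E1 - \<eta> * t k * m k / 2 * ((g1 + gg - DD) / 2 + ge + eD)
     + s * (m k - 1 - \<kappa> k) * E + \<eta> * m k / 2 * (t k - s + \<gamma>) * (gg + ge)"
    using cocoercive_descent[of k]
    unfolding gh g1h E_def[symmetric] E1_def[symmetric] DD_def[symmetric] r_def[symmetric] kr by simp
  moreover have "P k - P (Suc k) = \<eta> / 4 * (t k - 1) * (m k - 1) * gg + s * (m k - 1) * E
      - \<eta> / 4 * t k * m k * g1 - s * m k * E1"
    by (simp add: P_def gg_def g1_def E_def E1_def t_Suc)
  moreover have "\<beta> * M * (t k - s) * DD - \<eta> / 4 * (t k * M) * DD + \<eta> / 4 * (2 * M * w + b + 1) * gg
      + \<eta> / 2 * t k * M * eD + \<eta> / 2 * M * (1 + w) * ge + s * \<kappa> k * E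
    \<le> \<eta> / 4 * (t k - 1) * (M - 1) * gg + s * (M - 1) * E - \<eta> / 4 * t k * M * g1 - s * M * E1"
    if "\<beta> * M * (t k - s) * DD \<le> - s * M * E1 - \<eta> * t k * M / 2 * ((g1 + gg - DD) / 2 + ge + eD)
     + s * (M - 1 - \<kappa> k) * E + \<eta> * M / 2 * (t k - s + \<gamma>) * (gg + ge)"
     "M = t k + b" "w = s - \<gamma> - 1"
    for M w
  proof -
    \<comment> \<open>Comparing coefficients, the surplus of |g_k|^2 is (\<eta>/4) (2 M w + M - t_k
      + 1); the shift b enters as M - t_k.\<close>
    have b: "b = M - t k" using that by simp
    show ?thesis using that(1) unfolding b that(3)
      by (simp add: algebra_simps) (simp add: field_simps)
  qed
  ultimately show ?thesis
    unfolding E_def[symmetric] DD_def[symmetric] gg_def[symmetric] ge_def[symmetric] eD_def[symmetric]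
    by (simp only:)
qed

lemma P_step_young:
  "P k - P (Suc k) \<ge>
    (2 / 3 * \<beta> - \<eta> / 4 - \<eta> * T / 4) * (m k * t k * (norm (D k))\<^sup>2)
    + \<eta> * \<gamma> / 4 * (m k * (norm (g k))\<^sup>2)
    - (\<eta> / 4 + \<beta> / (10 * T)) * (m k * t k * S k) + s * \<kappa> k * (g k \<bullet> v k)"
proof -
  have 1: "\<beta> * m k * (t k - s) * (norm (D k))\<^sup>2 \<ge> 2 / 3 * \<beta> * (m k * t k * (norm (D k))\<^sup>2)"
  proof -
    have "\<beta> * m k * (norm (D k))\<^sup>2 * (t k - s) \<ge> \<beta> * m k * (norm (D k))\<^sup>2 * (2 / 3 * t k)"
      using t_gt_3s[of k] beta_pos m_pos[of k] by (intro mult_left_mono) auto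
    then show ?thesis by (simp add: mult_ac)
  qed
  \<comment> \<open>What \<open>young_eg\<close> leaves of the |g_k|^2 gain: a quarter of the
    \<open>sg\<close> part, which suffices because \<open>sg\<close> >= 2 \<gamma>.\<close>
  have "\<eta> * \<gamma> / 4 * m k \<le> \<eta> / 4 * (2 * m k * sg + b + 1) - \<eta> / 2 * (3 / 4 * sg * m k + b / 2)"
  proof -
    have "\<gamma> \<le> sg / 2" using sg_ge by linarith
    then have "\<gamma> * m k \<le> sg / 2 * m k" using m_pos[of k] by (intro mult_right_mono) auto
    then have "\<eta> / 4 * (\<gamma> * m k) \<le> \<eta> / 4 * (sg / 2 * m k + 1)"
      using eta_pos by (intro mult_left_mono) linarith+
    moreover have eq: "\<eta> / 4 * (2 * M * w + b + 1) - \<eta> / 2 * (3 / 4 * w * M + b / 2) = \<eta> / 4 * (w / 2 * M + 1)" for M w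
      by (simp add: field_simps)
    have "\<eta> * \<gamma> / 4 * m k = \<eta> / 4 * (\<gamma> * m k)" by simp
    ultimately show ?thesis unfolding eq by (simp only:)
  qed
  then have "\<eta> * \<gamma> / 4 * m k * (norm (g k))\<^sup>2 \<le> (\<eta> / 4 * (2 * m k * sg + b + 1) - \<eta> / 2 * (3 / 4 * sg * m k + b / 2)) * (norm (g k))\<^sup>2"
    by (rule mult_right_mono) simp
  then have 2: "\<eta> * \<gamma> / 4 * (m k * (norm (g k))\<^sup>2) \<le> \<eta> / 4 * (2 * m k * sg + b + 1) * (norm (g k))\<^sup>2 + - (\<eta> / 2 * (3 / 4 * sg * m k + b / 2)) * (norm (g k))\<^sup>2"
    by (simp only: left_diff_distrib mult.assoc) simp
  have 3: "(2 / 3 * \<beta> - \<eta> / 4 - \<eta> * T / 4) * (m k * t k * (norm (D k))\<^sup>2) =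
     2 / 3 * \<beta> * (m k * t k * (norm (D k))\<^sup>2) - \<eta> / 4 * (t k * m k) * (norm (D k))\<^sup>2 - \<eta> * T / 4 * (m k * t k * (norm (D k))\<^sup>2)"
    unfolding left_diff_distrib by (simp only: mult_ac)
  have 4: "(\<eta> / 4 + \<beta> / (10 * T)) * (m k * t k * S k) = \<eta> / 4 * (m k * t k * S k) + \<beta> / (10 * T) * (m k * t k * S k)"
    by (rule distrib_right)
  have 5: "- (\<eta> * T / 4) * (m k * t k * (norm (D k))\<^sup>2) = - (\<eta> * T / 4 * (m k * t k * (norm (D k))\<^sup>2))"
    by simp
  show ?thesis
    using P_step[of k] 1 2 young_eD[of k] young_eg[of k] unfolding 3 4 5 by linarith
qed

lemma z_weighted_step:
  assumes "xs \<in> zer G"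
  shows "c k * (norm (z k - xs))\<^sup>2 - c (Suc k) * (norm (z (Suc k) - xs))\<^sup>2 \<ge>
    s * \<kappa> k * (49 / 50 * \<beta> * (norm (h k))\<^sup>2 + h k \<bullet> (y k - y (k - d k)))
    - s * \<kappa> k * (e k \<bullet> v k) - s * \<kappa> k * (g k \<bullet> v k)"
proof -
  define q where "q = \<gamma> * afp_eta \<eta> s \<tau> k / s"
  have sk: "s * \<kappa> k \<ge> 0" using s_gt_1 kappa_pos[of k] by simp
  have cq: "c k * (2 * q) = s * \<kappa> k" using kappa_c[of k] by (simp add: q_def mult_ac)
  \<comment> \<open>Monotonicity of c lets both squared distances carry the same weight c_k.\<close>
  have "c k * (norm (z (Suc k) - xs))\<^sup>2 \<ge> c (Suc k) * (norm (z (Suc k) - xs))\<^sup>2"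
    using c_mono[of k] by (intro mult_right_mono) auto
  then have "c k * (norm (z k - xs))\<^sup>2 - c (Suc k) * (norm (z (Suc k) - xs))\<^sup>2
     \<ge> c k * ((norm (z k - xs))\<^sup>2 - (norm (z (Suc k) - xs))\<^sup>2)"
    unfolding right_diff_distrib by linarith
  also have "c k * ((norm (z k - xs))\<^sup>2 - (norm (z (Suc k) - xs))\<^sup>2)
     = c k * (2 * q) * (h k \<bullet> (z k - xs) - q / 2 * (norm (h k))\<^sup>2)"
    unfolding z_descent q_def[symmetric] by (simp add: algebra_simps)
  also have "\<dots> = s * \<kappa> k * (h k \<bullet> (z k - xs) - q / 2 * (norm (h k))\<^sup>2)" by (simp only: cq)
  \<comment> \<open>The quadratic term of the z-step costs q / 2 <= \<beta> / 50, which leaves 49/50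
    of the co-coercivity gain.\<close>
  also have "\<dots> \<ge> s * \<kappa> k * (\<beta> * (norm (h k))\<^sup>2 + h k \<bullet> (y k - y (k - d k)) - h k \<bullet> v k - \<beta> / 50 * (norm (h k))\<^sup>2)"
    using h_inner_z[OF assms, of k] z_step_le[of k, folded q_def] sk
    by (intro mult_left_mono diff_mono mult_right_mono) auto
  also have "s * \<kappa> k * (\<beta> * (norm (h k))\<^sup>2 + h k \<bullet> (y k - y (k - d k)) - h k \<bullet> v k - \<beta> / 50 * (norm (h k))\<^sup>2)
     = s * \<kappa> k * (49 / 50 * \<beta> * (norm (h k))\<^sup>2 + h k \<bullet> (y k - y (k - d k))) - s * \<kappa> k * (e k \<bullet> v k) - s * \<kappa> k * (g k \<bullet> v k)"
  proof -
    have "h k \<bullet> v k = e k \<bullet> v k + g k \<bullet> v k" by (simp add: inner_diff_left)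
    moreover have "a * (\<beta> * hh + hy - (ev + gv) - \<beta> / 50 * hh) = a * (49 / 50 * \<beta> * hh + hy) - a * ev - a * gv"
      for a hh hy ev gv by (simp add: field_simps)
    ultimately show ?thesis by (simp only:)
  qed
  finally show ?thesis .
qed

text \<open>Adding the two inequalities cancels the terms with s \<kappa>_k <g_k, v_k>. The
  constants are sums of earlier costs: 3/20 = 1/10 + 1/20 for S, and 67/100 = 49/50 - 31/100 for
  |h_k|^2.\<close>

lemma Ly_step_young:
  assumes "xs \<in> zer G"
  shows "Ly xs k - Ly xs (Suc k) \<ge>
    (2 / 3 * \<beta> - \<eta> / 4 - \<eta> * T / 4) * (m k * t k * (norm (D k))\<^sup>2)
    + \<eta> * \<gamma> / 4 * (m k * (norm (g k))\<^sup>2)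
    - (\<eta> / 4 + 3 * \<beta> / (20 * T)) * (m k * t k * S k)
    + 67 / 100 * s * \<beta> * (\<kappa> k * (norm (h k))\<^sup>2)
    - 3 / 10 * s * \<eta> * (\<kappa> k * (\<Sum>j\<in>{k - \<tau>..<k}. (norm (h j))\<^sup>2))
    - s ^ 3 * T / \<beta> * (\<kappa> k * (\<Sum>j\<in>{k - \<tau>..<k}. (norm (v j))\<^sup>2 / (t j)\<^sup>2))
    - 5 * s ^ 3 * T\<^sup>2 / \<beta> * (\<kappa> k * ((norm (v k))\<^sup>2 / (t k)\<^sup>2))"
proof -
  define H V where "H = (\<Sum>j\<in>{k - \<tau>..<k}. (norm (h j))\<^sup>2)"
    and "V = (\<Sum>j\<in>{k - \<tau>..<k}. (norm (v j))\<^sup>2 / (t j)\<^sup>2)"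
  have sk: "s * \<kappa> k \<ge> 0" using s_gt_1 kappa_pos[of k] by simp
  have "s * \<kappa> k * (49 / 50 * \<beta> * (norm (h k))\<^sup>2 + h k \<bullet> (y k - y (k - d k)))
    \<ge> s * \<kappa> k * (49 / 50 * \<beta> * (norm (h k))\<^sup>2 + (- (31 / 100 * \<beta>) * (norm (h k))\<^sup>2 - 3 / 10 * \<eta> * H - T * s\<^sup>2 / \<beta> * V))"
    using young_delay[of k] sk unfolding H_def[symmetric] V_def[symmetric]
    by (intro mult_left_mono add_left_mono) auto
  also have "s * \<kappa> k * (49 / 50 * \<beta> * (norm (h k))\<^sup>2 + (- (31 / 100 * \<beta>) * (norm (h k))\<^sup>2 - 3 / 10 * \<eta> * H - T * s\<^sup>2 / \<beta> * V))
    = 67 / 100 * s * \<beta> * (\<kappa> k * (norm (h k))\<^sup>2) - 3 / 10 * s * \<eta> * (\<kappa> k * H) - s ^ 3 * T / \<beta> * (\<kappa> k * V)"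
    using beta_pos by (simp add: field_simps power2_eq_square power3_eq_cube)
  finally have 1: "s * \<kappa> k * (49 / 50 * \<beta> * (norm (h k))\<^sup>2 + h k \<bullet> (y k - y (k - d k)))
    \<ge> 67 / 100 * s * \<beta> * (\<kappa> k * (norm (h k))\<^sup>2) - 3 / 10 * s * \<eta> * (\<kappa> k * H) - s ^ 3 * T / \<beta> * (\<kappa> k * V)" .
  have 2: "(\<eta> / 4 + 3 * \<beta> / (20 * T)) * (m k * t k * S k)
      = (\<eta> / 4 + \<beta> / (10 * T)) * (m k * t k * S k) + \<beta> / (20 * T) * (m k * t k * S k)"
    using T_ge_1 by (simp add: field_simps)
  have 3: "- \<beta> / (20 * T) * (m k * t k * S k) = - (\<beta> / (20 * T) * (m k * t k * S k))" by simp
  show ?thesis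
    using P_step_young[of k] z_weighted_step[OF assms, of k] 1 young_ev[of k]
    unfolding Ly_def H_def[symmetric] V_def[symmetric] 2 3 by linarith
qed

section \<open>Summation over k and absorption of the errors\<close>

lemma kappa_div_mono: "i \<le> j \<Longrightarrow> \<kappa> j / t j \<le> \<kappa> i / t i"
  using kappa_mono[of i j] kappa_pos[of j] t_mono[of i j] t_pos[of i] by (intro frac_le) auto

text \<open>v_{k+1} is a convex combination, with weight s / t_k on a multiple of h_k, so convexity
  of the square preserves the full contraction factor of |v_k|^2; the small weight costs a factor
  t_k / s on |h_k|^2.\<close>

lemma norm_v_Suc_le:
  "(norm (v (Suc k)))\<^sup>2 \<le> (1 - s / t k) * (norm (v k))\<^sup>2 + \<eta>\<^sup>2 * t k / (4 * s) * (norm (h k))\<^sup>2"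
proof -
  define \<theta> a where "\<theta> = s / t k" and "a = (1 - \<gamma> / s) * \<eta> / 2"
  have th: "0 < \<theta>" "\<theta> < 1" using t_pos[of k] s_gt_1 by (auto simp: \<theta>_def)
  have a: "0 \<le> a" "a \<le> \<eta> / 2"
    using gamma_pos s_ge eta_pos s_gt_1 by (auto simp: a_def field_simps)
  have "v (Suc k) = (1 - \<theta>) *\<^sub>R v k - a *\<^sub>R h k" unfolding \<theta>_def a_def by (rule v_Suc)
  then have "(norm (v (Suc k)))\<^sup>2 = (norm ((1 - \<theta>) *\<^sub>R v k + \<theta> *\<^sub>R ((- a / \<theta>) *\<^sub>R h k)))\<^sup>2"
    using th by simp
  also have "\<dots> \<le> ((1 - \<theta>) * norm (v k) + \<theta> * norm ((- a / \<theta>) *\<^sub>R h k))\<^sup>2"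
    using th norm_triangle_ineq[of "(1 - \<theta>) *\<^sub>R v k" "\<theta> *\<^sub>R ((- a / \<theta>) *\<^sub>R h k)"]
    by (intro power_mono) auto
  also have "\<dots> \<le> (1 - \<theta>) * (norm (v k))\<^sup>2 + \<theta> * (norm ((- a / \<theta>) *\<^sub>R h k))\<^sup>2"
  proof -
    have "((1 - \<theta>) * p + \<theta> * q)\<^sup>2 \<le> (1 - \<theta>) * p\<^sup>2 + \<theta> * q\<^sup>2" for p q
    proof -
      have "0 \<le> \<theta> * (1 - \<theta>) * (p - q)\<^sup>2" using th by simp
      then show ?thesis by (simp add: power2_eq_square algebra_simps)
    qed
    then show ?thesis by blast
  qed
  also have "\<theta> * (norm ((- a / \<theta>) *\<^sub>R h k))\<^sup>2 = a\<^sup>2 / \<theta> * (norm (h k))\<^sup>2"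
    using th by (simp add: power_mult_distrib power_divide power2_eq_square)
  also have "\<dots> \<le> (\<eta> / 2)\<^sup>2 / \<theta> * (norm (h k))\<^sup>2"
    using a th by (intro mult_right_mono divide_right_mono power_mono) auto
  also have "(\<eta> / 2)\<^sup>2 / \<theta> = \<eta>\<^sup>2 * t k / (4 * s)" by (simp add: \<theta>_def power_divide)
  finally show ?thesis unfolding \<theta>_def by simp
qed

(* Telescopes kappa k / t k * |v k|^2: the weights decrease, v 0 = 0, and the contraction
   factor 1 - s / t k of the recursion leaves s * kappa k * |v k|^2 / (t k)^2 behind. *)
lemma sum_kappa_v_le:
  "(\<Sum>k<K. \<kappa> k * ((norm (v k))\<^sup>2 / (t k)\<^sup>2)) \<le> \<eta>\<^sup>2 / (4 * s\<^sup>2) * (\<Sum>k<K. \<kappa> k * (norm (h k))\<^sup>2)"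
proof -
  have "s * (\<Sum>k<K. \<kappa> k * ((norm (v k))\<^sup>2 / (t k)\<^sup>2)) + \<kappa> K / t K * (norm (v K))\<^sup>2
     \<le> \<eta>\<^sup>2 / (4 * s) * (\<Sum>k<K. \<kappa> k * (norm (h k))\<^sup>2)"
  proof (induction K)
    case 0
    show ?case by (simp add: v_zero)
  next
    case (Suc K)
    have "\<kappa> (Suc K) / t (Suc K) * (norm (v (Suc K)))\<^sup>2 \<le> \<kappa> K / t K * (norm (v (Suc K)))\<^sup>2"
      using kappa_div_mono[of K "Suc K"] by (intro mult_right_mono) auto
    also have "\<dots> \<le> \<kappa> K / t K * ((1 - s / t K) * (norm (v K))\<^sup>2 + \<eta>\<^sup>2 * t K / (4 * s) * (norm (h K))\<^sup>2)"
      using kappa_pos[of K] t_pos[of K] by (intro mult_left_mono norm_v_Suc_le) auto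
    also have "\<dots> = \<kappa> K / t K * (norm (v K))\<^sup>2 - s * (\<kappa> K * ((norm (v K))\<^sup>2 / (t K)\<^sup>2))
       + \<eta>\<^sup>2 / (4 * s) * (\<kappa> K * (norm (h K))\<^sup>2)"
      using t_pos[of K] by (simp add: field_simps power2_eq_square)
    finally show ?case using Suc.IH by (simp add: distrib_left)
  qed
  moreover have "\<kappa> K / t K * (norm (v K))\<^sup>2 \<ge> 0"
    using kappa_pos[of K] t_pos[of K] by auto
  ultimately have "s * (\<Sum>k<K. \<kappa> k * ((norm (v k))\<^sup>2 / (t k)\<^sup>2)) \<le> s * (\<eta>\<^sup>2 / (4 * s\<^sup>2) * (\<Sum>k<K. \<kappa> k * (norm (h k))\<^sup>2))"
    using s_gt_1 by (simp add: power2_eq_square)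
  then show ?thesis by (rule mult_left_le_imp_le) (use s_gt_1 in auto)
qed

(* 7/3 = 1 + 1 + 1/3 comes from expanding the sum of (1 + i/t)^2 over i = 1..T, with T + 1 <= t. *)
lemma window_weight: "(\<Sum>i\<in>{1..\<tau>}. m (j + i) * t (j + i)) \<le> 7 / 3 * T * (m j * t j)"
proof -
  have *: "m (j + i) * t (j + i) \<le> (m j * t j) * (1 + real i / t j)\<^sup>2" for i
  proof -
    have ti: "t (j + i) = t j * (1 + real i / t j)" using t_pos[of j] by (simp add: afp_t_def field_simps)
    have "real i \<le> m j * (real i / t j)" using t_pos[of j] b_pos by (simp add: field_simps)
    then have "m (j + i) \<le> m j * (1 + real i / t j)" by (simp add: afp_t_def distrib_left)
    then have "m (j + i) * t (j + i) \<le> m j * (1 + real i / t j) * (t j * (1 + real i / t j))"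
      unfolding ti[symmetric] using t_pos[of "j + i"] by (intro mult_right_mono) auto
    then show ?thesis by (simp add: power2_eq_square mult_ac)
  qed
  define u where "u = 1 / t j"
  have u: "u > 0" "(T + 1) * u \<le> 1" using t_pos[of j] t_gt_3s[of j] t_ge[of j] s_gt_1 by (auto simp: u_def field_simps)
  have gauss: "(\<Sum>i\<in>{1..n}. (1 + real i * u)\<^sup>2) = n + u * n * (n + 1) + u\<^sup>2 * n * (n + 1) * (2 * n + 1) / 6" for n
    by (induction n) (simp_all add: power2_eq_square field_simps)
  have "(\<Sum>i\<in>{1..\<tau>}. m (j + i) * t (j + i)) \<le> (\<Sum>i\<in>{1..\<tau>}. (m j * t j) * (1 + real i * u)\<^sup>2)"
    using * by (intro sum_mono) (simp add: u_def)
  also have "\<dots> = (m j * t j) * (T + u * T * (T + 1) + u\<^sup>2 * T * (T + 1) * (2 * T + 1) / 6)"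
    by (simp only: sum_distrib_left[symmetric] gauss)
  also have "\<dots> \<le> (m j * t j) * (7 / 3 * T)"
  proof (intro mult_left_mono)
    have "T * ((T + 1) * u) \<le> T * 1" using u by (intro mult_left_mono) auto
    moreover have "((T + 1) * u) * ((2 * T + 1) * u) \<le> 1 * 2"
    proof (intro mult_mono)
      have "(2 * T + 1) * u \<le> 2 * ((T + 1) * u)" using u by (simp add: algebra_simps)
      with u show "(2 * T + 1) * u \<le> 2" by linarith
    qed (use u in auto)
    then have "T * (((T + 1) * u) * ((2 * T + 1) * u)) \<le> T * 2" by (intro mult_left_mono) auto
    moreover have "u * T * (T + 1) = T * ((T + 1) * u)"
      "u\<^sup>2 * T * (T + 1) * (2 * T + 1) = T * (((T + 1) * u) * ((2 * T + 1) * u))"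
      by (simp_all add: power2_eq_square mult_ac)
    ultimately show "T + u * T * (T + 1) + u\<^sup>2 * T * (T + 1) * (2 * T + 1) / 6 \<le> 7 / 3 * T"
      by linarith
  qed (use m_pos[of j] t_pos[of j] in auto)
  finally show ?thesis by (simp only: mult_ac)
qed

lemma sum_mtS_le: "(\<Sum>k<K. m k * t k * S k) \<le> 7 / 3 * T * (\<Sum>k<K. m k * t k * (norm (D k))\<^sup>2)"
proof -
  have "(\<Sum>k<K. m k * t k * S k) \<le> (\<Sum>j<K. (norm (D j))\<^sup>2 * (\<Sum>i\<in>{1..\<tau>}. m (j + i) * t (j + i)))"
    unfolding S_def using m_pos t_pos by (intro sum_window_le) (auto intro: less_imp_le)
  also have "\<dots> \<le> (\<Sum>j<K. (norm (D j))\<^sup>2 * (7 / 3 * T * (m j * t j)))"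
    using window_weight by (intro sum_mono mult_left_mono) auto
  also have "\<dots> = 7 / 3 * T * (\<Sum>k<K. m k * t k * (norm (D k))\<^sup>2)"
    by (simp only: sum_distrib_left mult_ac)
  finally show ?thesis .
qed

theorem Ly_sum:
  assumes "xs \<in> zer G"
  shows "Ly xs K + \<beta> / 10 * (\<Sum>k<K. m k * t k * (norm (D k))\<^sup>2) + \<eta> * \<gamma> / 4 * (\<Sum>k<K. m k * (norm (g k))\<^sup>2)
     + s * \<beta> / 2 * (\<Sum>k<K. \<kappa> k * (norm (h k))\<^sup>2) \<le> Ly xs 0"
proof -
  define SD Sg SS Sh SH SV Sv where "SD = (\<Sum>k<K. m k * t k * (norm (D k))\<^sup>2)"
    and "Sg = (\<Sum>k<K. m k * (norm (g k))\<^sup>2)" and "SS = (\<Sum>k<K. m k * t k * S k)"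
    and "Sh = (\<Sum>k<K. \<kappa> k * (norm (h k))\<^sup>2)"
    and "SH = (\<Sum>k<K. \<kappa> k * (\<Sum>j\<in>{k - \<tau>..<k}. (norm (h j))\<^sup>2))"
    and "SV = (\<Sum>k<K. \<kappa> k * (\<Sum>j\<in>{k - \<tau>..<k}. (norm (v j))\<^sup>2 / (t j)\<^sup>2))"
    and "Sv = (\<Sum>k<K. \<kappa> k * ((norm (v k))\<^sup>2 / (t k)\<^sup>2))"
  note defs = SD_def Sg_def SS_def Sh_def SH_def SV_def Sv_def
  have "Ly xs 0 - Ly xs K = (\<Sum>k<K. Ly xs k - Ly xs (Suc k))"
    by (simp add: sum_lessThan_telescope')
  also have "\<dots> \<ge> (\<Sum>k<K. (2 / 3 * \<beta> - \<eta> / 4 - \<eta> * T / 4) * (m k * t k * (norm (D k))\<^sup>2)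
    + \<eta> * \<gamma> / 4 * (m k * (norm (g k))\<^sup>2)
    - (\<eta> / 4 + 3 * \<beta> / (20 * T)) * (m k * t k * S k)
    + 67 / 100 * s * \<beta> * (\<kappa> k * (norm (h k))\<^sup>2)
    - 3 / 10 * s * \<eta> * (\<kappa> k * (\<Sum>j\<in>{k - \<tau>..<k}. (norm (h j))\<^sup>2))
    - s ^ 3 * T / \<beta> * (\<kappa> k * (\<Sum>j\<in>{k - \<tau>..<k}. (norm (v j))\<^sup>2 / (t j)\<^sup>2))
    - 5 * s ^ 3 * T\<^sup>2 / \<beta> * (\<kappa> k * ((norm (v k))\<^sup>2 / (t k)\<^sup>2)))"
    using Ly_step_young[OF assms] by (rule sum_mono)
  finally have main: "(2 / 3 * \<beta> - \<eta> / 4 - \<eta> * T / 4) * SD + \<eta> * \<gamma> / 4 * Sg - (\<eta> / 4 + 3 * \<beta> / (20 * T)) * SS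
    + 67 / 100 * s * \<beta> * Sh - 3 / 10 * s * \<eta> * SH - s ^ 3 * T / \<beta> * SV - 5 * s ^ 3 * T\<^sup>2 / \<beta> * Sv
    \<le> Ly xs 0 - Ly xs K"
    unfolding defs sum.distrib sum_subtractf sum_distrib_left[symmetric] .
  have pos: "\<beta> > 0" "T > 0" "s > 0" "\<eta> > 0" using beta_pos T_ge_1 s_gt_1 eta_pos by auto
  have nn: "SD \<ge> 0" "Sh \<ge> 0" unfolding defs
    using kappa_pos m_pos t_pos by (auto intro!: sum_nonneg mult_nonneg_nonneg intro: less_imp_le)
  have am: "antimono \<kappa>" using kappa_mono by (auto simp: antimono_def)
  have SH: "SH \<le> T * Sh" unfolding defs
    using kappa_pos am by (intro sum_window_antimono_le) (auto intro: less_imp_le)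
  have SV: "SV \<le> T * Sv" unfolding defs
    using kappa_pos am by (intro sum_window_antimono_le) (auto intro: less_imp_le)
  have Sv: "Sv \<le> \<eta>\<^sup>2 / (4 * s\<^sup>2) * Sh" unfolding defs by (rule sum_kappa_v_le)
  have SS: "SS \<le> 7 / 3 * T * SD" unfolding defs by (rule sum_mtS_le)
  have "(\<eta> / 4 + 3 * \<beta> / (20 * T)) * SS \<le> (\<eta> / 4 + 3 * \<beta> / (20 * T)) * (7 / 3 * T * SD)"
    using SS pos by (intro mult_left_mono add_nonneg_nonneg) auto
  \<comment> \<open>The window factor (7/3) T cancels the 1 / T that was built into the Young
    parameters, leaving 7/20 \<beta>.\<close>
  also have "\<dots> = (7 / 12 * (\<eta> * T) + 7 / 20 * \<beta>) * SD" using pos by (simp add: field_simps)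
  finally have 1: "(\<eta> / 4 + 3 * \<beta> / (20 * T)) * SS \<le> (7 / 12 * (\<eta> * T) + 7 / 20 * \<beta>) * SD" .
  \<comment> \<open>The |D|^2 budget in units of \<beta>, with \<eta> <= \<eta> T <= 3/17: 2/3 -
    7/20 - (1/4 + 1/4 + 7/12) (3/17) > 1/10.\<close>
  have "\<beta> / 10 \<le> 2 / 3 * \<beta> - \<eta> / 4 - \<eta> * T / 4 - (7 / 12 * (\<eta> * T) + 7 / 20 * \<beta>)"
    using eta_T_le eta_le_beta pos by linarith
  then have "\<beta> / 10 * SD \<le> (2 / 3 * \<beta> - \<eta> / 4 - \<eta> * T / 4 - (7 / 12 * (\<eta> * T) + 7 / 20 * \<beta>)) * SD"
    using nn by (intro mult_right_mono) auto
  with 1 have D: "\<beta> / 10 * SD \<le> (2 / 3 * \<beta> - \<eta> / 4 - \<eta> * T / 4) * SD - (\<eta> / 4 + 3 * \<beta> / (20 * T)) * SS"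
    unfolding left_diff_distrib by linarith
  have "3 / 10 * s * \<eta> * SH \<le> 3 / 10 * s * \<eta> * (T * Sh)" using SH pos by (intro mult_left_mono) auto
  also have "\<dots> = 3 / 10 * (\<eta> * T) * (s * Sh)" by simp
  also have "\<dots> \<le> 3 / 10 * (3 / 17 * \<beta>) * (s * Sh)"
    using eta_T_le pos nn by (intro mult_right_mono) auto
  finally have 2: "3 / 10 * s * \<eta> * SH \<le> 9 / 170 * (s * \<beta> * Sh)" by simp
  have "s ^ 3 * T / \<beta> * SV \<le> s ^ 3 * T / \<beta> * (T * Sv)" using SV pos by (intro mult_left_mono) auto
  then have "s ^ 3 * T / \<beta> * SV + 5 * s ^ 3 * T\<^sup>2 / \<beta> * Sv \<le> 6 * s ^ 3 * T\<^sup>2 / \<beta> * Sv"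
    using pos by (simp add: field_simps power2_eq_square)
  \<comment> \<open>Here |v|^2 is converted into |h|^2. The factor \<eta>^2 joins T^2 to form
    (\<eta> T)^2, so no bare power of T survives; with 9/170 and 27/578 spent, more than 1/2 of
    67/100 remains.\<close>
  also have "\<dots> \<le> 6 * s ^ 3 * T\<^sup>2 / \<beta> * (\<eta>\<^sup>2 / (4 * s\<^sup>2) * Sh)"
    using Sv pos by (intro mult_left_mono) auto
  also have "\<dots> = 3 / 2 * (\<eta> * T)\<^sup>2 * (s / \<beta> * Sh)"
    using pos by (simp add: field_simps power2_eq_square power3_eq_cube)
  also have "\<dots> \<le> 3 / 2 * (3 / 17 * \<beta>)\<^sup>2 * (s / \<beta> * Sh)"
    using eta_T_le pos nn by (intro mult_right_mono mult_left_mono power_mono) auto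
  also have "\<dots> = 27 / 578 * (s * \<beta> * Sh)"
    using pos by (simp add: field_simps power2_eq_square)
  finally have 3: "s ^ 3 * T / \<beta> * SV + 5 * s ^ 3 * T\<^sup>2 / \<beta> * Sv \<le> 27 / 578 * (s * \<beta> * Sh)" .
  have "s * \<beta> / 2 * Sh = 1 / 2 * (s * \<beta> * Sh)" "67 / 100 * s * \<beta> * Sh = 67 / 100 * (s * \<beta> * Sh)" by simp_all
  moreover have "0 \<le> s * \<beta> * Sh" using pos nn by simp
  ultimately have H: "s * \<beta> / 2 * Sh \<le> 67 / 100 * s * \<beta> * Sh - 3 / 10 * s * \<eta> * SH - s ^ 3 * T / \<beta> * SV - 5 * s ^ 3 * T\<^sup>2 / \<beta> * Sv"
    using 2 3 by linarith
  from main D H show ?thesis unfolding defs[symmetric] by linarith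
qed


subsection \<open>Nonasymptotic rate\<close>

lemma norm_G_le:
  assumes "xs \<in> zer G"
  shows "\<beta> * norm (G w) \<le> norm (w - xs)"
proof (cases "G w = 0")
  case False
  have "\<beta> * norm (G w) * norm (G w) \<le> norm (w - xs) * norm (G w)"
    using cocoercive_zer[OF assms, of w] norm_cauchy_schwarz[of "G w" "w - xs"]
    by (simp add: power2_eq_square mult_ac)
  then show ?thesis by (rule mult_right_le_imp_le) (use False in auto)
qed simp

text \<open>The missing 1/3, compared with 4 s / 3, is the room in which \<open>Ly_0_le\<close>
  places the excess of |G y0|^2.\<close>

lemma kappa_factor_0: "\<kappa> 0 * (1 - s / t 0) \<le> (4 * s - 1) / 3"
proof -
  have t0: "t 0 = 3 * s + T" by (simp add: afp_t_def)
  have pos: "3 * s + T > 0" "s + T > 0" "s > 0" "T > 0" using s_gt_1 T_ge_1 by auto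
  have "s * b / t 0 = s * (s - 1) / (s + T) + T / (3 * s + T)"
  proof -
    have "s * (A * q / w + T / s) / q = s * A / w + T / q" if "q > 0" "w > 0" for A q w
      using that pos by (simp add: field_simps)
    from this[OF pos(1,2)] show ?thesis by (simp only: t0 b_def)
  qed
  then have "\<kappa> 0 = (s - 1) + s * (s - 1) / (s + T) + T / (3 * s + T)" by (simp add: \<kappa>_def)
  also have "(s - 1) + s * (s - 1) / (s + T) = (s - 1) * ((2 * s + T) / (s + T))"
    using pos by (simp add: field_simps)
  finally have "\<kappa> 0 * (1 - s / t 0) = (s - 1) * ((2 * s + T) / (s + T) * (1 - s / t 0)) + T / (3 * s + T) * (1 - s / t 0)"
    by (simp add: distrib_right)
  also have "\<dots> \<le> (s - 1) * (4 / 3) + 1"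
  proof (intro add_mono mult_left_mono)
    \<comment> \<open>The product in question is (2 s + T)^2 / ((s + T) (3 s + T)), which approaches
      4/3 as T / s tends to 0; 4 s T + T^2 is the exact slack.\<close>
    have "0 \<le> 4 * s * T + T * T" using pos by auto
    then have "3 * ((2 * s + T) * (2 * s + T)) \<le> 4 * ((s + T) * (3 * s + T))" by (simp add: algebra_simps)
    then have "(2 * s + T) * (2 * s + T) / ((s + T) * (3 * s + T)) \<le> 4 / 3"
      using pos by (simp add: pos_divide_le_eq)
    moreover have "1 - s / t 0 = (2 * s + T) / (3 * s + T)" using pos unfolding t0 by (simp add: field_simps)
    ultimately show "(2 * s + T) / (s + T) * (1 - s / t 0) \<le> 4 / 3" by simp
    have "T / (3 * s + T) * (1 - s / t 0) \<le> 1 * 1"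
      using pos t_pos[of 0] by (intro mult_mono) auto
    then show "T / (3 * s + T) * (1 - s / t 0) \<le> 1" by simp
  qed (use s_gt_1 in auto)
  also have "\<dots> = (4 * s - 1) / 3" by (simp add: field_simps)
  finally show ?thesis .
qed

definition R0sq :: "'a \<Rightarrow> real" where
  "R0sq xs = \<eta> * (3 * s + T - 1)\<^sup>2 / 2 * (norm (G y0))\<^sup>2 + 2 * s ^ 3 / (\<eta> * \<gamma>) * (norm (y0 - xs))\<^sup>2"

(* The coefficient of |G y0|^2 in Ly xs 0 is too large by up to a factor 3/2; the excess is moved
   to |y0 - xs|^2 using beta |G y0| <= |y0 - xs| and the smallness of eta. *)
lemma Ly_0_le:
  assumes "xs \<in> zer G"
  shows "Ly xs 0 \<le> 2 / 3 * R0sq xs"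
proof -
  define t' where "t' = 3 * s + T - 1"
  define N where "N = norm (y0 - xs)"
  have pos: "t' > 0" "s > 0" "\<eta> > 0" "\<gamma> > 0" using s_gt_1 T_ge_1 eta_pos gamma_pos by (auto simp: t'_def)
  have "s * (\<eta> * (3 + (17 + 7 * (s - \<gamma> - 1)) * T)) \<le> s * (3 * \<beta>)"
    using eta_T pos by (intro mult_left_mono) auto
  moreover have "\<eta> * (3 * t') \<le> \<eta> * (s * (3 + (17 + 7 * (s - \<gamma> - 1)) * T))"
  proof (intro mult_left_mono)
    have "1 * T \<le> s * T" "s * 1 \<le> s * T" using s_gt_1 T_ge_1 by (intro mult_mono; simp)+
    moreover define w where "w = s - \<gamma> - 1"
    have "0 \<le> s * (w * T)" using sg_ge pos T_ge_1 unfolding w_def by (intro mult_nonneg_nonneg) auto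
    moreover have "s * (3 + (17 + 7 * w) * T) = 3 * s + 17 * (s * T) + 7 * (s * (w * T))"
      by (simp add: algebra_simps)
    moreover have "3 * t' \<le> 3 * s + 17 * Y + 7 * X" if "1 * T \<le> Y" "s * 1 \<le> Y" "0 \<le> X" for X Y
      using that s_gt_1 by (simp add: t'_def)
    ultimately show "3 * t' \<le> s * (3 + (17 + 7 * (s - \<gamma> - 1)) * T)" unfolding w_def[symmetric]
      by (simp only:)
  qed (use pos in auto)
  ultimately have "\<eta> * t' \<le> s * \<beta>" by (simp add: mult_ac)
  then have "\<eta> * t' * norm (G y0) \<le> s * \<beta> * norm (G y0)" by (rule mult_right_mono) simp
  also have "\<dots> \<le> s * N" using norm_G_le[OF assms, of y0] pos by (simp add: N_def)
  finally have "(\<eta> * t' * norm (G y0))\<^sup>2 \<le> (s * N)\<^sup>2" using pos by (intro power_mono) auto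
  moreover have "(\<eta> * t' * norm (G y0))\<^sup>2 * \<gamma> \<le> (\<eta> * t' * norm (G y0))\<^sup>2 * 1"
    using gamma_le_1 by (intro mult_left_mono) auto
  ultimately have "\<eta>\<^sup>2 * t'\<^sup>2 * (norm (G y0))\<^sup>2 * \<gamma> \<le> s\<^sup>2 * N\<^sup>2"
    by (simp add: power_mult_distrib)
  moreover have "0 \<le> s\<^sup>2 * N\<^sup>2" by simp
  ultimately have "\<eta>\<^sup>2 * t'\<^sup>2 * (norm (G y0))\<^sup>2 * \<gamma> \<le> 2 * (s\<^sup>2 * N\<^sup>2)" by linarith
  then have 1: "\<eta> / 6 * t'\<^sup>2 * (norm (G y0))\<^sup>2 \<le> s\<^sup>2 / (3 * (\<gamma> * \<eta>)) * N\<^sup>2"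
    using pos by (simp add: field_simps power2_eq_square)
  have "c 0 \<le> s\<^sup>2 * ((4 * s - 1) / 3) / (\<gamma> * \<eta>)"
    unfolding c_def using kappa_factor_0 pos by (intro divide_right_mono mult_left_mono) auto
  then have 2: "c 0 * N\<^sup>2 \<le> s\<^sup>2 * ((4 * s - 1) / 3) / (\<gamma> * \<eta>) * N\<^sup>2" by (rule mult_right_mono) simp
  have t0: "t 0 - 1 = t'" by (simp add: afp_t_def t'_def)
  have "\<eta> / 4 * t' * (m 0 - 1) \<le> \<eta> / 4 * t' * (2 * t')"
    using b_le t0 pos by (intro mult_left_mono) (auto simp: t'_def)
  then have 3: "\<eta> / 4 * t' * (m 0 - 1) * (norm (G y0))\<^sup>2 \<le> \<eta> / 2 * t'\<^sup>2 * (norm (G y0))\<^sup>2"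
    by (intro mult_right_mono) (auto simp: power2_eq_square)
  have "Ly xs 0 = \<eta> / 4 * t' * (m 0 - 1) * (norm (G y0))\<^sup>2 + c 0 * N\<^sup>2"
    using v_zero by (simp add: Ly_def P_def t0 y_zero z_zero N_def)
  also have "\<dots> \<le> \<eta> / 2 * t'\<^sup>2 * (norm (G y0))\<^sup>2 + s\<^sup>2 * ((4 * s - 1) / 3) / (\<gamma> * \<eta>) * N\<^sup>2"
    using 2 3 by linarith
  also have "\<dots> \<le> \<eta> / 3 * t'\<^sup>2 * (norm (G y0))\<^sup>2 + 4 / 3 * s ^ 3 / (\<eta> * \<gamma>) * N\<^sup>2"
  proof -
    have A: "\<eta> / 2 * t'\<^sup>2 * (norm (G y0))\<^sup>2 = \<eta> / 3 * t'\<^sup>2 * (norm (G y0))\<^sup>2 + \<eta> / 6 * t'\<^sup>2 * (norm (G y0))\<^sup>2"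
      by (simp add: field_simps)
    have B: "s\<^sup>2 * ((4 * s - 1) / 3) / (\<gamma> * \<eta>) * N\<^sup>2 = 4 / 3 * s ^ 3 / (\<eta> * \<gamma>) * N\<^sup>2 - s\<^sup>2 / (3 * (\<gamma> * \<eta>)) * N\<^sup>2"
      using pos by (simp add: field_simps power2_eq_square power3_eq_cube)
    have "a + b' \<le> a1 + b1" if "a = a1 + a2" "b' = b1 - b2" "a2 \<le> b2" for a a1 a2 b' b1 b2 :: real
      using that by linarith
    from this[OF A B 1] show ?thesis .
  qed
  also have "\<dots> = 2 / 3 * R0sq xs" by (simp add: R0sq_def N_def t'_def)
  finally show ?thesis .
qed

text \<open><g_k, v_k> = <g_k, y_k - xs> + <g_k, xs - z_k>: the first product is nonnegative by
  co-coercivity, and q is the Young parameter for which the second spends exactly the share \<theta>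
  of c_k |z_k - xs|^2.\<close>

lemma Ly_ge:
  assumes "xs \<in> zer G" "\<theta> > 0"
  shows "(\<eta> / 4 * (t k - 1) * (m k - 1) - \<eta> * (m k - 1)\<^sup>2 / (12 * \<theta>)) * (norm (g k))\<^sup>2
    + (1 - \<theta>) * c k * (norm (z k - xs))\<^sup>2 \<le> Ly xs k"
proof -
  define M where "M = m k - 1"
  define q where "q = s * M / (4 * \<theta> * c k)"
  have pos: "M > 0" "s > 0" "c k > 0" "\<theta> > 0" using b_le_t[of k] b_pos s_gt_1 c_pos[of k] assms by (auto simp: M_def)
  then have q: "q > 0" by (simp add: q_def)
  have "g k \<bullet> (y k - xs) \<ge> \<beta> * (norm (g k))\<^sup>2" by (rule cocoercive_zer[OF assms(1)])
  moreover have "\<beta> * (norm (g k))\<^sup>2 \<ge> 0" using beta_pos by simp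
  moreover have "g k \<bullet> v k = g k \<bullet> (y k - xs) + g k \<bullet> (xs - z k)" by (simp add: inner_diff_right)
  ultimately have "g k \<bullet> v k \<ge> g k \<bullet> (xs - z k)" by linarith
  also have "g k \<bullet> (xs - z k) \<ge> - (q * (norm (g k))\<^sup>2 + (norm (xs - z k))\<^sup>2 / (4 * q))"
    by (rule inner_Young[OF q])
  finally have "s * M * (g k \<bullet> v k) \<ge> s * M * - (q * (norm (g k))\<^sup>2 + (norm (xs - z k))\<^sup>2 / (4 * q))"
    using pos by (intro mult_left_mono) auto
  moreover have "s * M * - (q * (norm (g k))\<^sup>2 + (norm (xs - z k))\<^sup>2 / (4 * q))
     = - (s * M * q * (norm (g k))\<^sup>2) - \<theta> * c k * (norm (z k - xs))\<^sup>2"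
    using pos by (simp add: q_def norm_minus_commute field_simps)
  moreover have "s * M * q * (norm (g k))\<^sup>2 \<le> \<eta> * M\<^sup>2 / (12 * \<theta>) * (norm (g k))\<^sup>2"
  proof (rule mult_right_mono)
    define C where "C = \<kappa> k * (1 - s / t k)"
    \<comment> \<open>The condition s >= 1 + 3 \<gamma> turns the denominator 4 \<theta> C into 12
      \<theta> \<gamma>, and \<gamma> cancels.\<close>
    have C: "3 * \<gamma> \<le> C" using kappa_factor_ge[of k] s_ge by (simp add: C_def)
    then have "C > 0" using gamma_pos by linarith
    have "s * M * q = \<eta> * M\<^sup>2 * \<gamma> / (4 * \<theta> * C)"
      using pos \<open>C > 0\<close> gamma_pos eta_pos
      by (simp add: q_def c_def flip: C_def) (simp add: field_simps power2_eq_square)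
    also have "\<dots> \<le> \<eta> * M\<^sup>2 / (12 * \<theta>)"
      using C \<open>C > 0\<close> pos eta_pos mult_left_mono[OF C, of "\<eta> * M\<^sup>2 * \<theta>"] by (simp add: field_simps)
    finally show "s * M * q \<le> \<eta> * M\<^sup>2 / (12 * \<theta>)" .
  qed simp
  ultimately show ?thesis
    unfolding Ly_def P_def M_def[symmetric] left_diff_distrib by simp
qed

lemma Ly_nonneg: "xs \<in> zer G \<Longrightarrow> Ly xs k \<ge> 0"
  and Ly_ge_g: "xs \<in> zer G \<Longrightarrow> \<eta> / 6 * (t k - 1)\<^sup>2 * (norm (g k))\<^sup>2 \<le> Ly xs k"
proof -
  assume xs: "xs \<in> zer G"
  define t' where "t' = t k - 1"
  have t': "0 < b" "b \<le> t'" using b_le_t b_pos by (auto simp: t'_def)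
  have "\<eta> / 12 * (2 * t'\<^sup>2) \<le> \<eta> / 12 * (3 * t' * (t' + b) - (t' + b)\<^sup>2)"
  proof (rule mult_left_mono)
    \<comment> \<open>The difference of the two sides is b (t' - b), so b <= t_k - 1 is what makes
      the |g_k|^2 coefficient quadratic in t_k.\<close>
    have "0 \<le> b * (t' - b)" using t' by simp
    then show "2 * t'\<^sup>2 \<le> 3 * t' * (t' + b) - (t' + b)\<^sup>2" by (simp add: power2_eq_square algebra_simps)
  qed (use eta_pos in auto)
  then have "\<eta> / 6 * t'\<^sup>2 \<le> \<eta> / 4 * t' * (t' + b) - \<eta> * (t' + b)\<^sup>2 / (12 * 1)"
    by (simp add: field_simps)
  then have "\<eta> / 6 * t'\<^sup>2 * (norm (g k))\<^sup>2 \<le> (\<eta> / 4 * t' * (t' + b) - \<eta> * (t' + b)\<^sup>2 / (12 * 1)) * (norm (g k))\<^sup>2"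
    by (rule mult_right_mono) simp
  moreover have eqs: "m k - 1 = t' + b" "t k - 1 = t'" by (simp_all add: t'_def)
  ultimately show *: "\<eta> / 6 * (t k - 1)\<^sup>2 * (norm (g k))\<^sup>2 \<le> Ly xs k"
    using Ly_ge[OF xs, of 1 k] unfolding eqs by simp
  have "0 \<le> \<eta> / 6 * (t k - 1)\<^sup>2 * (norm (g k))\<^sup>2" using eta_pos by simp
  with * show "Ly xs k \<ge> 0" by linarith
qed

lemma t_gt_1: "t k - 1 > 0"
  using b_le_t[of k] b_pos by linarith

lemma Ly_bounds:
  assumes "xs \<in> zer G"
  shows "Ly xs K \<le> Ly xs 0"
    and "(\<Sum>k<K. m k * t k * (norm (D k))\<^sup>2) \<le> Ly xs 0 / (\<beta> / 10)"
    and "(\<Sum>k<K. m k * (norm (g k))\<^sup>2) \<le> Ly xs 0 / (\<eta> * \<gamma> / 4)"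
    and "(\<Sum>k<K. \<kappa> k * (norm (h k))\<^sup>2) \<le> Ly xs 0 / (s * \<beta> / 2)"
proof -
  have nn: "0 \<le> (\<Sum>k<K. m k * t k * (norm (D k))\<^sup>2)" "0 \<le> (\<Sum>k<K. m k * (norm (g k))\<^sup>2)"
    "0 \<le> (\<Sum>k<K. \<kappa> k * (norm (h k))\<^sup>2)"
    using m_pos t_pos kappa_pos by (auto intro!: sum_nonneg mult_nonneg_nonneg intro: less_imp_le)
  have pos: "\<beta> / 10 > 0" "\<eta> * \<gamma> / 4 > 0" "s * \<beta> / 2 > 0" using beta_pos eta_pos gamma_pos s_gt_1 by auto
  have nn': "0 \<le> \<beta> / 10 * (\<Sum>k<K. m k * t k * (norm (D k))\<^sup>2)" "0 \<le> \<eta> * \<gamma> / 4 * (\<Sum>k<K. m k * (norm (g k))\<^sup>2)"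
    "0 \<le> s * \<beta> / 2 * (\<Sum>k<K. \<kappa> k * (norm (h k))\<^sup>2)"
    using nn pos by (intro mult_nonneg_nonneg; simp)+
  note L = Ly_sum[OF assms, of K] Ly_nonneg[OF assms, of K]
  show "Ly xs K \<le> Ly xs 0" using L nn' by linarith
  show "(\<Sum>k<K. m k * t k * (norm (D k))\<^sup>2) \<le> Ly xs 0 / (\<beta> / 10)"
    unfolding pos_le_divide_eq[OF pos(1)] mult.commute[of "sum _ _"] using L nn' by linarith
  show "(\<Sum>k<K. m k * (norm (g k))\<^sup>2) \<le> Ly xs 0 / (\<eta> * \<gamma> / 4)"
    unfolding pos_le_divide_eq[OF pos(2)] mult.commute[of "sum _ _"] using L nn' by linarith
  show "(\<Sum>k<K. \<kappa> k * (norm (h k))\<^sup>2) \<le> Ly xs 0 / (s * \<beta> / 2)"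
    unfolding pos_le_divide_eq[OF pos(3)] mult.commute[of "sum _ _"] using L nn' by linarith
qed

theorem norm_g_le:
  assumes "xs \<in> zer G"
  shows "(norm (g k))\<^sup>2 \<le> 4 * R0sq xs / (\<eta> * (real k + 3 * s + T - 1)\<^sup>2)"
proof -
  \<comment> \<open>The constant 4 of the rate is the quotient of 2/3 and 1/6.\<close>
  have "\<eta> / 6 * (t k - 1)\<^sup>2 * (norm (g k))\<^sup>2 \<le> 2 / 3 * R0sq xs"
    using Ly_ge_g[OF assms, of k] Ly_bounds(1)[OF assms, of k] Ly_0_le[OF assms] by linarith
  moreover have "\<eta> * (t k - 1)\<^sup>2 > 0" using eta_pos t_gt_1[of k] by simp
  ultimately have "(norm (g k))\<^sup>2 \<le> 4 * R0sq xs / (\<eta> * (t k - 1)\<^sup>2)"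
    by (subst pos_le_divide_eq) (auto simp: mult_ac)
  then show ?thesis by (simp add: afp_t_def)
qed


subsection \<open>Asymptotics\<close>

lemma summable_of_sum_le:
  assumes "\<And>k. 0 \<le> f k" "\<And>K. (\<Sum>k<K. f k) \<le> (B::real)"
  shows "summable f"
  using assms by (intro summableI_nonneg_bounded) auto

context
  fixes xs assumes xs: "xs \<in> zer G"
begin

lemma summable_m_g: "summable (\<lambda>k. m k * (norm (g k))\<^sup>2)"
  using Ly_bounds(3)[OF xs] m_pos by (intro summable_of_sum_le) (auto intro!: mult_nonneg_nonneg intro: less_imp_le)

lemma summable_mt_S: "summable (\<lambda>k. m k * t k * S k)"
proof (rule summable_of_sum_le)
  show "0 \<le> m k * t k * S k" for k
    using m_pos[of k] t_pos[of k] S_nonneg[of k] by simp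
  fix K
  have "(\<Sum>k<K. m k * t k * S k) \<le> 7 / 3 * T * (\<Sum>k<K. m k * t k * (norm (D k))\<^sup>2)"
    by (rule sum_mtS_le)
  also have "\<dots> \<le> 7 / 3 * T * (Ly xs 0 / (\<beta> / 10))"
    using Ly_bounds(2)[OF xs, of K] T_ge_1 by (intro mult_left_mono) auto
  finally show "(\<Sum>k<K. m k * t k * S k) \<le> 7 / 3 * T * (Ly xs 0 / (\<beta> / 10))" .
qed

lemma summable_t_g: "summable (\<lambda>k. t k * (norm (g k))\<^sup>2)"
proof (rule summable_comparison_test'[OF summable_m_g, of 0])
  fix k
  have "t k * (norm (g k))\<^sup>2 \<le> m k * (norm (g k))\<^sup>2"
    using b_pos by (intro mult_right_mono) auto
  then show "norm (t k * (norm (g k))\<^sup>2) \<le> m k * (norm (g k))\<^sup>2"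
    using t_pos[of k] by simp
qed

lemma summable_t_h: "summable (\<lambda>k. t k * (norm (h k))\<^sup>2)"
proof (rule summable_comparison_test'[of "\<lambda>k. 2 * (t k * (norm (g k))\<^sup>2) + 2 * T * (m k * t k * S k)" 0])
  show "summable (\<lambda>k. 2 * (t k * (norm (g k))\<^sup>2) + 2 * T * (m k * t k * S k))"
    by (intro summable_add summable_mult summable_t_g summable_mt_S)
  fix k
  have "(norm (h k))\<^sup>2 \<le> 2 * (norm (g k))\<^sup>2 + 2 * (norm (e k))\<^sup>2"
  proof -
    have "norm (h k) \<le> norm (g k) + norm (e k)" using norm_triangle_ineq[of "g k" "e k"] by simp
    then have "(norm (h k))\<^sup>2 \<le> (norm (g k) + norm (e k))\<^sup>2" by (intro power_mono) auto
    also have "\<dots> \<le> 2 * (norm (g k))\<^sup>2 + 2 * (norm (e k))\<^sup>2"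
      using sum_squares_bound[of "norm (g k)" "norm (e k)"] by (simp add: power2_sum)
    finally show ?thesis .
  qed
  also have "(norm (e k))\<^sup>2 \<le> T * S k" by (rule norm_e_le)
  finally have "t k * (norm (h k))\<^sup>2 \<le> t k * (2 * (norm (g k))\<^sup>2 + 2 * (T * S k))"
    using t_pos[of k] by (intro mult_left_mono) auto
  moreover have "1 * (t k * (T * S k)) \<le> m k * (t k * (T * S k))"
    using t_gt_1[of k] b_pos T_ge_1 S_nonneg[of k] by (intro mult_right_mono) auto
  ultimately have "t k * (norm (h k))\<^sup>2 \<le> 2 * (t k * (norm (g k))\<^sup>2) + 2 * T * (m k * t k * S k)"
    by (simp add: algebra_simps)
  then show "norm (t k * (norm (h k))\<^sup>2) \<le> 2 * (t k * (norm (g k))\<^sup>2) + 2 * T * (m k * t k * S k)"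
    using t_pos[of k] by simp
qed

text \<open>In \<open>norm_v_Suc_le\<close> the contraction loss s |v_k|^2 / t_k moves to the left,
  and the source is a multiple of the summable t_k |h_k|^2.\<close>

lemma v_convergent: "convergent (\<lambda>k. (norm (v k))\<^sup>2)"
  and summable_v: "summable (\<lambda>k. (norm (v k))\<^sup>2 / t k)"
proof -
  have q: "summable (\<lambda>k. \<eta>\<^sup>2 / (4 * s) * (t k * (norm (h k))\<^sup>2))"
    by (intro summable_mult summable_t_h)
  have q0: "0 \<le> \<eta>\<^sup>2 / (4 * s) * (t k * (norm (h k))\<^sup>2)" "0 \<le> s * ((norm (v k))\<^sup>2 / t k)" for k
    using s_gt_1 t_pos[of k] by simp_all
  have step: "(norm (v (Suc k)))\<^sup>2 + s * ((norm (v k))\<^sup>2 / t k) \<le> (norm (v k))\<^sup>2 + \<eta>\<^sup>2 / (4 * s) * (t k * (norm (h k))\<^sup>2)" for k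
    using norm_v_Suc_le[of k] by (simp add: algebra_simps)
  show "convergent (\<lambda>k. (norm (v k))\<^sup>2)"
    by (rule almost_decreasing_convergent(1)[OF q0(2) q0(1) q _ step, of 0]) simp
  have "summable (\<lambda>k. s * ((norm (v k))\<^sup>2 / t k))"
    by (rule almost_decreasing_convergent(2)[OF q0(2) q0(1) q _ step, of 0]) simp
  then show "summable (\<lambda>k. (norm (v k))\<^sup>2 / t k)"
    using summable_mult[of "\<lambda>k. s * ((norm (v k))\<^sup>2 / t k)" "1 / s"] s_gt_1 by simp
qed

lemma t_eq: "t k = real k + (3 * s + T)" by (simp add: afp_t_def)

lemma norm_v_sq_tendsto_0: "(\<lambda>k. (norm (v k))\<^sup>2) \<longlonglongrightarrow> 0"
proof -
  obtain l where l: "(\<lambda>k. (norm (v k))\<^sup>2) \<longlonglongrightarrow> l" using v_convergent by (auto simp: convergent_def)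
  moreover have "l = 0"
    using s_gt_1 summable_v by (intro limit_eq_0_of_summable_divide[OF l, of "3 * s + T"]) (auto simp: t_eq)
  ultimately show ?thesis by simp
qed

lemma v_tendsto_0: "v \<longlonglongrightarrow> 0"
proof -
  have "(\<lambda>k. sqrt ((norm (v k))\<^sup>2)) \<longlonglongrightarrow> sqrt 0"
    by (intro tendsto_real_sqrt norm_v_sq_tendsto_0)
  then show ?thesis by (simp add: tendsto_norm_zero_iff)
qed

text \<open>The weight t_k / 2 is the one for which both terms belong to families already known to
  be summable.\<close>

lemma abs_inner_g_v: "\<bar>g k \<bullet> v k\<bar> \<le> (t k * (norm (g k))\<^sup>2 + (norm (v k))\<^sup>2 / t k) / 2"
proof -
  have t: "t k / 2 > 0" using t_pos[of k] by simp
  have "- (t k / 2 * (norm (g k))\<^sup>2 + (norm (v k))\<^sup>2 / (4 * (t k / 2))) \<le> g k \<bullet> v k"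
    by (rule inner_Young[OF t])
  moreover have "- (t k / 2 * (norm (g k))\<^sup>2 + (norm (- v k))\<^sup>2 / (4 * (t k / 2))) \<le> g k \<bullet> (- v k)"
    by (rule inner_Young[OF t])
  then have "- (t k / 2 * (norm (g k))\<^sup>2 + (norm (v k))\<^sup>2 / (4 * (t k / 2))) \<le> - (g k \<bullet> v k)"
    by (simp only: norm_minus_cancel inner_minus_right)
  moreover have "t k / 2 * (norm (g k))\<^sup>2 + (norm (v k))\<^sup>2 / (4 * (t k / 2)) = (t k * (norm (g k))\<^sup>2 + (norm (v k))\<^sup>2 / t k) / 2"
    using t by (simp add: field_simps)
  ultimately show ?thesis by linarith
qed

text \<open>Half of the |g_k|^2 term absorbs the cross term without reference to a zero of G. As
  |v_k|^2 tends to 0, this both bounds P below and reads the o(1/k^2) rate off from P -> 0.\<close>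

lemma P_ge: "\<eta> / 8 * (t k - 1)\<^sup>2 * (norm (g k))\<^sup>2 - 4 * s\<^sup>2 / \<eta> * (norm (v k))\<^sup>2 \<le> P k"
proof -
  define t' M where "t' = t k - 1" and "M = m k - 1"
  have pos: "t' > 0" "M \<ge> t'" "M \<le> 2 * t'" "s > 0" "\<eta> > 0"
    using t_gt_1[of k] b_pos b_le_t[of k] s_gt_1 eta_pos by (auto simp: t'_def M_def)
  define q where "q = \<eta> * t' / (8 * s)"
  have q: "q > 0" using pos by (simp add: q_def)
  have "g k \<bullet> v k \<ge> - (q * (norm (g k))\<^sup>2 + (norm (v k))\<^sup>2 / (4 * q))" by (rule inner_Young[OF q])
  then have "s * M * (g k \<bullet> v k) \<ge> s * M * - (q * (norm (g k))\<^sup>2 + (norm (v k))\<^sup>2 / (4 * q))"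
    using pos by (intro mult_left_mono) auto
  moreover have "s * M * - (q * (norm (g k))\<^sup>2 + (norm (v k))\<^sup>2 / (4 * q))
     = - (\<eta> / 8 * t' * M * (norm (g k))\<^sup>2) - 2 * s\<^sup>2 / \<eta> * (M / t') * (norm (v k))\<^sup>2"
    using pos by (simp add: q_def field_simps power2_eq_square)
  moreover have "2 * s\<^sup>2 / \<eta> * (M / t') * (norm (v k))\<^sup>2 \<le> 2 * s\<^sup>2 / \<eta> * 2 * (norm (v k))\<^sup>2"
    using pos by (intro mult_right_mono mult_left_mono) (auto simp: field_simps)
  moreover have "\<eta> / 8 * t' * t' * (norm (g k))\<^sup>2 \<le> \<eta> / 8 * t' * M * (norm (g k))\<^sup>2"
    using pos by (intro mult_right_mono mult_left_mono) auto
  moreover have "P k = \<eta> / 8 * t' * M * (norm (g k))\<^sup>2 + \<eta> / 8 * t' * M * (norm (g k))\<^sup>2 + s * M * (g k \<bullet> v k)"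
    by (simp add: P_def t'_def M_def)
  moreover have "2 * s\<^sup>2 / \<eta> * 2 * (norm (v k))\<^sup>2 = 4 * s\<^sup>2 / \<eta> * (norm (v k))\<^sup>2"
    "\<eta> / 8 * t' * t' * (norm (g k))\<^sup>2 = \<eta> / 8 * t'\<^sup>2 * (norm (g k))\<^sup>2"
    by (simp_all add: power2_eq_square)
  ultimately show ?thesis unfolding t'_def[symmetric] by linarith
qed

text \<open>P is studied alone because \<open>Ly\<close> retains c_k |z_k - xs|^2, whose limit need
  not be 0 for the given xs. The price is that <g_k, v_k> no longer cancels; it is summable after
  division by no weight, since \<kappa> is bounded.\<close>

lemma P_convergent: "convergent P"
proof -
  define w where "w k = (\<eta> / 4 + \<beta> / (10 * T)) * (m k * t k * S k)
    + s * \<kappa> 0 / 2 * (t k * (norm (g k))\<^sup>2 + (norm (v k))\<^sup>2 / t k)" for k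
  have w: "summable w" unfolding w_def
    by (intro summable_add summable_mult summable_mt_S summable_t_g summable_v)
  have w0: "0 \<le> w k" for k
    unfolding w_def using eta_pos beta_pos T_ge_1 m_pos[of k] t_pos[of k] S_nonneg[of k] s_gt_1 kappa_pos[of 0] b_pos
    by (intro add_nonneg_nonneg mult_nonneg_nonneg divide_nonneg_nonneg) auto
  have step: "P (Suc k) + 0 \<le> P k + w k" for k
  proof -
    have "0 \<le> (2 / 3 * \<beta> - \<eta> / 4 - \<eta> * T / 4) * (m k * t k * (norm (D k))\<^sup>2)"
      using eta_T_le eta_le_beta beta_pos m_pos[of k] t_pos[of k] by (intro mult_nonneg_nonneg) auto
    moreover have "0 \<le> \<eta> * \<gamma> / 4 * (m k * (norm (g k))\<^sup>2)"
      using eta_pos gamma_pos m_pos[of k] by (intro mult_nonneg_nonneg) auto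
    moreover have "s * \<kappa> k * (g k \<bullet> v k) \<ge> - (s * \<kappa> 0 / 2 * (t k * (norm (g k))\<^sup>2 + (norm (v k))\<^sup>2 / t k))"
    proof -
      have "s * \<kappa> k * \<bar>g k \<bullet> v k\<bar> \<le> s * \<kappa> 0 * ((t k * (norm (g k))\<^sup>2 + (norm (v k))\<^sup>2 / t k) / 2)"
        using abs_inner_g_v[of k] kappa_mono[of 0 k] kappa_pos[of k] kappa_pos[of 0] s_gt_1
        by (intro mult_mono) auto
      moreover have "- (s * \<kappa> k * (g k \<bullet> v k)) \<le> s * \<kappa> k * \<bar>g k \<bullet> v k\<bar>"
        using kappa_pos[of k] s_gt_1 unfolding mult_minus_right[symmetric] by (intro mult_left_mono) auto
      moreover have "s * \<kappa> 0 * ((t k * (norm (g k))\<^sup>2 + (norm (v k))\<^sup>2 / t k) / 2)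
          = s * \<kappa> 0 / 2 * (t k * (norm (g k))\<^sup>2 + (norm (v k))\<^sup>2 / t k)" by simp
      ultimately show ?thesis by linarith
    qed
    ultimately show ?thesis using P_step_young[of k] unfolding w_def by linarith
  qed
  have "Bseq (\<lambda>k. (norm (v k))\<^sup>2)" using v_convergent by (rule convergent_imp_Bseq)
  then obtain B where B: "\<And>k. (norm (v k))\<^sup>2 \<le> B" by (auto simp: Bseq_def)
  have "- (4 * s\<^sup>2 / \<eta> * B) \<le> P k" for k
  proof -
    have "4 * s\<^sup>2 / \<eta> * (norm (v k))\<^sup>2 \<le> 4 * s\<^sup>2 / \<eta> * B"
      using B eta_pos by (intro mult_left_mono) auto
    moreover have "0 \<le> \<eta> / 8 * (t k - 1)\<^sup>2 * (norm (g k))\<^sup>2" using eta_pos by simp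
    ultimately show ?thesis using P_ge[of k] by linarith
  qed
  then show ?thesis using almost_decreasing_convergent(1)[of "\<lambda>_. 0" w _ P, OF _ w0 w _ step] by blast
qed

lemma P_tendsto_0: "P \<longlonglongrightarrow> 0"
proof -
  obtain l where l: "P \<longlonglongrightarrow> l" using P_convergent by (auto simp: convergent_def)
  have "summable (\<lambda>k. \<bar>P k\<bar> / t k)"
  proof (rule summable_comparison_test'[of "\<lambda>k. \<eta> / 2 * (t k * (norm (g k))\<^sup>2) + s * (t k * (norm (g k))\<^sup>2 + (norm (v k))\<^sup>2 / t k)" 0])
    show "summable (\<lambda>k. \<eta> / 2 * (t k * (norm (g k))\<^sup>2) + s * (t k * (norm (g k))\<^sup>2 + (norm (v k))\<^sup>2 / t k))"
      by (intro summable_add summable_mult summable_t_g summable_v)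
    fix k
    have M: "0 \<le> m k - 1" "m k - 1 \<le> 2 * t k" "0 \<le> t k - 1" "t k > 0" "s > 0"
      using m_le[of k] t_gt_1[of k] b_pos t_pos[of k] s_gt_1 by auto
    have "\<bar>P k\<bar> \<le> \<eta> / 4 * (t k - 1) * (m k - 1) * (norm (g k))\<^sup>2 + s * (m k - 1) * \<bar>g k \<bullet> v k\<bar>"
    proof -
      have "0 \<le> \<eta> / 4 * (t k - 1) * (m k - 1) * (norm (g k))\<^sup>2" using M eta_pos by (intro mult_nonneg_nonneg) auto
      moreover have "\<bar>s * (m k - 1) * (g k \<bullet> v k)\<bar> = s * (m k - 1) * \<bar>g k \<bullet> v k\<bar>"
        using M unfolding abs_mult by simp
      ultimately show ?thesis unfolding P_def by linarith
    qed
    also have "\<dots> \<le> \<eta> / 4 * t k * (2 * t k) * (norm (g k))\<^sup>2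
        + s * (2 * t k) * ((t k * (norm (g k))\<^sup>2 + (norm (v k))\<^sup>2 / t k) / 2)"
      using M abs_inner_g_v[of k] eta_pos by (intro add_mono mult_mono) auto
    also have "\<dots> = (\<eta> / 2 * (t k * (norm (g k))\<^sup>2) + s * (t k * (norm (g k))\<^sup>2 + (norm (v k))\<^sup>2 / t k)) * t k"
      using M by (simp add: field_simps)
    finally show "norm (\<bar>P k\<bar> / t k) \<le> \<eta> / 2 * (t k * (norm (g k))\<^sup>2) + s * (t k * (norm (g k))\<^sup>2 + (norm (v k))\<^sup>2 / t k)"
      using M by (simp add: pos_divide_le_eq)
  qed
  then have "l = 0"
    using s_gt_1 by (intro limit_eq_0_of_summable_divide[OF l, of "3 * s + T"]) (auto simp: t_eq)
  with l show ?thesis by simp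
qed

lemma t_sq_g_tendsto_0: "(\<lambda>k. (t k - 1)\<^sup>2 * (norm (g k))\<^sup>2) \<longlonglongrightarrow> 0"
proof (rule tendsto_sandwich[OF _ _ tendsto_const])
  have "(\<lambda>k. 8 / \<eta> * (P k + 4 * s\<^sup>2 / \<eta> * (norm (v k))\<^sup>2)) \<longlonglongrightarrow> 8 / \<eta> * (0 + 4 * s\<^sup>2 / \<eta> * 0)"
    by (intro tendsto_intros P_tendsto_0 norm_v_sq_tendsto_0)
  then show "(\<lambda>k. 8 / \<eta> * (P k + 4 * s\<^sup>2 / \<eta> * (norm (v k))\<^sup>2)) \<longlonglongrightarrow> 0" by simp
  show "\<forall>\<^sub>F k in sequentially. (t k - 1)\<^sup>2 * (norm (g k))\<^sup>2 \<le> 8 / \<eta> * (P k + 4 * s\<^sup>2 / \<eta> * (norm (v k))\<^sup>2)"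
  proof (intro always_eventually allI)
    fix k
    have "\<eta> / 8 * ((t k - 1)\<^sup>2 * (norm (g k))\<^sup>2) \<le> P k + 4 * s\<^sup>2 / \<eta> * (norm (v k))\<^sup>2"
      using P_ge[of k] by simp
    then have "8 / \<eta> * (\<eta> / 8 * ((t k - 1)\<^sup>2 * (norm (g k))\<^sup>2)) \<le> 8 / \<eta> * (P k + 4 * s\<^sup>2 / \<eta> * (norm (v k))\<^sup>2)"
      using eta_pos by (intro mult_left_mono) auto
    then show "(t k - 1)\<^sup>2 * (norm (g k))\<^sup>2 \<le> 8 / \<eta> * (P k + 4 * s\<^sup>2 / \<eta> * (norm (v k))\<^sup>2)"
      using eta_pos by simp
  qed
qed auto

lemma k_plus_T_le: "real k + T \<le> t k - 1"
  using s_gt_1 by (simp add: afp_t_def)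

theorem rate_tendsto_0: "(\<lambda>k. (real k + T)\<^sup>2 * (norm (g k))\<^sup>2) \<longlonglongrightarrow> 0"
proof (rule tendsto_sandwich[OF _ _ tendsto_const t_sq_g_tendsto_0])
  show "\<forall>\<^sub>F k in sequentially. (real k + T)\<^sup>2 * (norm (g k))\<^sup>2 \<le> (t k - 1)\<^sup>2 * (norm (g k))\<^sup>2"
    using k_plus_T_le by (intro always_eventually allI mult_right_mono power_mono) auto
qed auto

theorem summable_rate: "summable (\<lambda>k. (real k + T) * (norm (g k))\<^sup>2)"
proof (rule summable_comparison_test'[OF summable_t_g, of 0])
  fix k
  have "(real k + T) * (norm (g k))\<^sup>2 \<le> t k * (norm (g k))\<^sup>2"
    using k_plus_T_le[of k] by (intro mult_right_mono) auto
  then show "norm ((real k + T) * (norm (g k))\<^sup>2) \<le> t k * (norm (g k))\<^sup>2" by simp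
qed

lemma g_tendsto_0: "g \<longlonglongrightarrow> 0"
proof -
  have "(\<lambda>k. (norm (g k))\<^sup>2) \<longlonglongrightarrow> 0"
  proof (rule tendsto_sandwich[OF _ _ tendsto_const rate_tendsto_0])
    show "\<forall>\<^sub>F k in sequentially. (norm (g k))\<^sup>2 \<le> (real k + T)\<^sup>2 * (norm (g k))\<^sup>2"
    proof (intro always_eventually allI)
      fix k
      have "1\<^sup>2 \<le> (real k + T)\<^sup>2" using T_ge_1 by (intro power_mono) auto
      then show "(norm (g k))\<^sup>2 \<le> (real k + T)\<^sup>2 * (norm (g k))\<^sup>2"
        using mult_right_mono[of 1 "(real k + T)\<^sup>2" "(norm (g k))\<^sup>2"] by simp
    qed
  qed auto
  then have "(\<lambda>k. sqrt ((norm (g k))\<^sup>2)) \<longlonglongrightarrow> sqrt 0" by (rule tendsto_real_sqrt)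
  then show ?thesis by (simp add: tendsto_norm_zero_iff)
qed

lemma h_tendsto_0: "h \<longlonglongrightarrow> 0"
proof -
  have "filterlim (\<lambda>k. k - d k) at_top sequentially"
    unfolding filterlim_at_top
  proof
    fix N
    show "\<forall>\<^sub>F k in sequentially. N \<le> k - d k"
      using eventually_ge_at_top[of "N + \<tau>"]
    proof eventually_elim
      case (elim k)
      then show ?case using delay_bound[of k] by linarith
    qed
  qed
  from filterlim_compose[OF g_tendsto_0 this] show ?thesis by simp
qed

text \<open>Without the weight c_k the z-step is almost decreasing for every zero: splitting <h_k,
  v_k> with weight t_k and using the drift bound leaves only errors that are already
  summable.\<close>

lemma fejer_convergent: "convergent (\<lambda>k. (norm (z k - xs))\<^sup>2)"
proof -
  define w where "w k = \<beta> / 25 * (31 / 50 * \<beta> * (t k * (norm (h k))\<^sup>2)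
     + 3 / 5 * \<eta> * (\<Sum>j\<in>{k - \<tau>..<k}. (norm (h j))\<^sup>2)
     + 2 * T * s\<^sup>2 / \<beta> * (\<Sum>j\<in>{k - \<tau>..<k}. (norm (v j))\<^sup>2 / (t j)\<^sup>2)
     + t k * (norm (h k))\<^sup>2 + (norm (v k))\<^sup>2 / t k)" for k
  have t1: "t k \<ge> 1" for k using t_gt_1[of k] by simp
  have sh: "summable (\<lambda>k. (norm (h k))\<^sup>2)"
  proof (rule summable_comparison_test'[OF summable_t_h, of 0])
    fix k
    show "norm ((norm (h k))\<^sup>2) \<le> t k * (norm (h k))\<^sup>2"
      using mult_right_mono[OF t1[of k], of "(norm (h k))\<^sup>2"] by simp
  qed
  have sv: "summable (\<lambda>k. (norm (v k))\<^sup>2 / (t k)\<^sup>2)"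
  proof (rule summable_comparison_test'[OF summable_v, of 0])
    fix k
    have "(norm (v k))\<^sup>2 / t k / t k \<le> (norm (v k))\<^sup>2 / t k / 1"
      using t1[of k] by (intro divide_left_mono) auto
    then show "norm ((norm (v k))\<^sup>2 / (t k)\<^sup>2) \<le> (norm (v k))\<^sup>2 / t k"
      by (simp add: power2_eq_square)
  qed
  have w: "summable w" unfolding w_def
    by (intro summable_mult summable_add summable_t_h summable_v summable_window sh sv) auto
  have nn: "0 \<le> (\<Sum>j\<in>{k - \<tau>..<k}. (norm (h j))\<^sup>2)" "0 \<le> (\<Sum>j\<in>{k - \<tau>..<k}. (norm (v j))\<^sup>2 / (t j)\<^sup>2)"
    "0 \<le> (norm (v k))\<^sup>2 / t k" "0 \<le> t k * (norm (h k))\<^sup>2" for k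
    using t_pos[of k] by (auto intro!: sum_nonneg)
  have w0: "0 \<le> w k" for k
    unfolding w_def using nn[of k] t_pos[of k] eta_pos beta_pos T_ge_1 by (intro mult_nonneg_nonneg add_nonneg_nonneg) auto
  have step: "(norm (z (Suc k) - xs))\<^sup>2 + 0 \<le> (norm (z k - xs))\<^sup>2 + w k" for k
  proof -
    define q where "q = \<gamma> * afp_eta \<eta> s \<tau> k / s"
    have q: "0 \<le> q" "q \<le> \<beta> / 25"
      using z_step_le[of k] gamma_pos eta_pos s_gt_1 t_pos[of k] by (auto simp: q_def afp_eta_def)
    define hh where "hh = (norm (h k))\<^sup>2"
    have hh: "0 \<le> hh" "hh \<le> t k * hh" using mult_right_mono[OF t1[of k], of hh] by (auto simp: hh_def)
    define R where "R = 31 / 50 * \<beta> * (t k * hh)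
     + 3 / 5 * \<eta> * (\<Sum>j\<in>{k - \<tau>..<k}. (norm (h j))\<^sup>2)
     + 2 * T * s\<^sup>2 / \<beta> * (\<Sum>j\<in>{k - \<tau>..<k}. (norm (v j))\<^sup>2 / (t j)\<^sup>2)
     + t k * hh + (norm (v k))\<^sup>2 / t k"
    have R0: "0 \<le> R" unfolding R_def hh_def using nn[of k] t_pos[of k] eta_pos beta_pos T_ge_1
      by (intro mult_nonneg_nonneg add_nonneg_nonneg) auto
    have hv: "h k \<bullet> v k \<le> (t k * hh + (norm (v k))\<^sup>2 / t k) / 2"
    proof -
      have "- (t k / 2 * (norm (h k))\<^sup>2 + (norm (- v k))\<^sup>2 / (4 * (t k / 2))) \<le> h k \<bullet> (- v k)"
        using t_pos[of k] by (intro inner_Young) auto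
      then have "- (t k / 2 * hh + (norm (v k))\<^sup>2 / (4 * (t k / 2))) \<le> - (h k \<bullet> v k)"
        by (simp only: hh_def norm_minus_cancel inner_minus_right)
      moreover have "t k / 2 * hh + (norm (v k))\<^sup>2 / (4 * (t k / 2)) = (t k * hh + (norm (v k))\<^sup>2 / t k) / 2"
        using t_pos[of k] by (simp add: field_simps)
      ultimately show ?thesis by linarith
    qed
    define H V where "H = (\<Sum>j\<in>{k - \<tau>..<k}. (norm (h j))\<^sup>2)"
      and "V = (\<Sum>j\<in>{k - \<tau>..<k}. (norm (v j))\<^sup>2 / (t j)\<^sup>2)"
    have "q * hh \<le> \<beta> * hh" using q beta_pos hh by (intro mult_right_mono) auto
    moreover have "0 \<le> \<beta> * hh" using beta_pos hh by simp
    moreover have "31 / 50 * \<beta> * hh \<le> 31 / 50 * \<beta> * (t k * hh)"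
      using beta_pos hh by (intro mult_left_mono) auto
    moreover have "- ((31 / 50 * \<beta> * hh + 3 / 5 * \<eta> * H + 2 * T * s\<^sup>2 / \<beta> * V) / 2) \<le> h k \<bullet> (y k - y (k - d k))"
    proof -
      have "- ((31 / 50 * \<beta> * hh + 3 / 5 * \<eta> * H + 2 * T * s\<^sup>2 / \<beta> * V) / 2)
          = - (31 / 100 * \<beta>) * hh - 3 / 10 * \<eta> * H - T * s\<^sup>2 / \<beta> * V"
        by (simp add: field_simps)
      with young_delay[of k] show ?thesis by (simp only: hh_def H_def V_def)
    qed
    moreover have "- (a' + a1 + a2 + th + vt) \<le> 2 * hz - qh"
      if "qh \<le> bh" "0 \<le> bh" "a \<le> a'" "- ((a + a1 + a2) / 2) \<le> hy" "bh + hy - hv \<le> hz" "hv \<le> (th + vt) / 2"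
      for a a' a1 a2 bh hv hy hz qh th vt :: real
      using that by argo
    ultimately have "- R \<le> 2 * (h k \<bullet> (z k - xs)) - q * hh"
      using h_inner_z[OF xs, of k] hv unfolding R_def hh_def[symmetric] H_def[symmetric] V_def[symmetric]
      by blast
    then have "q * - R \<le> q * (2 * (h k \<bullet> (z k - xs)) - q * hh)" using q by (intro mult_left_mono) auto
    also have "\<dots> = (norm (z k - xs))\<^sup>2 - (norm (z (Suc k) - xs))\<^sup>2"
      unfolding z_descent q_def hh_def ..
    finally have "(norm (z (Suc k) - xs))\<^sup>2 \<le> (norm (z k - xs))\<^sup>2 + q * R" by simp
    moreover have "q * R \<le> \<beta> / 25 * R" using q R0 by (intro mult_right_mono) auto
    moreover have "w k = \<beta> / 25 * R" by (simp add: w_def R_def hh_def)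
    ultimately show ?thesis by linarith
  qed
  show ?thesis
    by (rule almost_decreasing_convergent(1)[of "\<lambda>_. 0" w 0, OF _ w0 w _ step]) auto
qed

end

section \<open>Convergence of the iterates to a zero\<close>

lemma G_continuous: "continuous_on UNIV G"
proof (rule lipschitz_on_continuous_on)
  show "(1 / \<beta>)-lipschitz_on UNIV G"
  proof (rule lipschitz_onI)
    fix u w
    have "\<beta> * (norm (G u - G w))\<^sup>2 \<le> (G u - G w) \<bullet> (u - w)"
      using G_cocoercive by (simp add: cocoercive_def)
    also have "\<dots> \<le> norm (G u - G w) * norm (u - w)" by (rule norm_cauchy_schwarz)
    finally have *: "\<beta> * norm (G u - G w) * norm (G u - G w) \<le> norm (u - w) * norm (G u - G w)"
      by (simp add: power2_eq_square mult_ac)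
    have "\<beta> * norm (G u - G w) \<le> norm (u - w)"
    proof (cases "G u = G w")
      case False
      from * show ?thesis by (rule mult_right_le_imp_le) (use False in auto)
    qed simp
    then show "dist (G u) (G w) \<le> 1 / \<beta> * dist u w"
      using beta_pos by (simp add: dist_norm field_simps)
  qed (use beta_pos in auto)
qed

text \<open>Opial's argument: a cluster point l of the bounded z is a zero by continuity, because y
  - z and G y tend to 0; the distance to l itself converges, and a subsequence forces its limit to
  be 0.\<close>

theorem iterates_converge:
  assumes "zer G \<noteq> {}"
  obtains l where "l \<in> zer G" "x \<longlonglongrightarrow> l" "y \<longlonglongrightarrow> l" "z \<longlonglongrightarrow> l"
proof -
  obtain xs where xs: "xs \<in> zer G" using assms by auto
  have "Bseq (\<lambda>k. (norm (z k - xs))\<^sup>2)"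
    using fejer_convergent[OF xs] by (rule convergent_imp_Bseq)
  then obtain B where B: "\<And>k. (norm (z k - xs))\<^sup>2 \<le> B" by (auto simp: Bseq_def)
  have "norm (z k - xs) \<le> sqrt B" for k using B[of k] by (rule real_le_rsqrt)
  then have "range z \<subseteq> cball xs (sqrt B)" by (auto simp: dist_norm norm_minus_commute)
  then have "bounded (range z)" by (rule bounded_subset[OF bounded_cball])
  then obtain l r where lr: "strict_mono r" "(z \<circ> r) \<longlonglongrightarrow> l"
    using bounded_imp_convergent_subsequence by blast
  have "(\<lambda>k. z (r k) + v (r k)) \<longlonglongrightarrow> l + 0"
    using lr LIMSEQ_subseq_LIMSEQ[OF v_tendsto_0[OF xs] lr(1)] by (intro tendsto_add) (auto simp: o_def)
  then have "(\<lambda>k. y (r k)) \<longlonglongrightarrow> l" by simp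
  then have "(\<lambda>k. g (r k)) \<longlonglongrightarrow> G l"
    using G_continuous by (intro continuous_on_tendsto_compose[of UNIV G]) auto
  moreover have "(\<lambda>k. g (r k)) \<longlonglongrightarrow> 0"
    using LIMSEQ_subseq_LIMSEQ[OF g_tendsto_0[OF xs] lr(1)] by (simp add: o_def)
  ultimately have "G l = 0" by (rule LIMSEQ_unique)
  then have l: "l \<in> zer G" by (simp add: zer_def)
  obtain L where L: "(\<lambda>k. (norm (z k - l))\<^sup>2) \<longlonglongrightarrow> L"
    using fejer_convergent[OF l] by (auto simp: convergent_def)
  have "(\<lambda>k. (norm (z (r k) - l))\<^sup>2) \<longlonglongrightarrow> (norm (l - l))\<^sup>2"
    using lr(2) by (intro tendsto_power tendsto_norm tendsto_diff tendsto_const) (simp add: o_def)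
  moreover have "(\<lambda>k. (norm (z (r k) - l))\<^sup>2) \<longlonglongrightarrow> L"
    using LIMSEQ_subseq_LIMSEQ[OF L lr(1)] by (simp add: o_def)
  ultimately have "L = (norm (l - l))\<^sup>2" by (rule LIMSEQ_unique[symmetric])
  then have "L = 0" by simp
  then have "(\<lambda>k. sqrt ((norm (z k - l))\<^sup>2)) \<longlonglongrightarrow> sqrt 0" using L by (intro tendsto_real_sqrt) simp
  then have z: "z \<longlonglongrightarrow> l" by (simp add: tendsto_norm_zero_iff LIM_zero_iff)
  have "(\<lambda>k. z k + v k) \<longlonglongrightarrow> l + 0" by (intro tendsto_add z v_tendsto_0[OF xs])
  then have y: "y \<longlonglongrightarrow> l" by simp
  have "(\<lambda>k. afp_eta \<eta> s \<tau> k *\<^sub>R h k) \<longlonglongrightarrow> 0"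
  proof (rule Lim_null_comparison)
    have "(\<lambda>k. 3 / 4 * \<eta> * norm (h k)) \<longlonglongrightarrow> 3 / 4 * \<eta> * 0"
      by (intro tendsto_mult_left tendsto_norm_zero h_tendsto_0[OF xs])
    then show "(\<lambda>k. 3 / 4 * \<eta> * norm (h k)) \<longlonglongrightarrow> 0" by simp
    show "\<forall>\<^sub>F k in sequentially. norm (afp_eta \<eta> s \<tau> k *\<^sub>R h k) \<le> 3 / 4 * \<eta> * norm (h k)"
      using afp_eta_bounds
      by (intro always_eventually allI) (simp only: norm_scaleR abs_of_nonneg, rule mult_right_mono, auto)
  qed
  then have "(\<lambda>k. x (Suc k)) \<longlonglongrightarrow> l - 0" unfolding x_Suc by (intro tendsto_diff y)
  \<comment> \<open>The value of x at 0 is arbitrary, so the limit is taken along the shifted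
    sequence.\<close>
  then have "x \<longlonglongrightarrow> l" by (simp add: filterlim_sequentially_Suc)
  from that[OF l this y z] show thesis .
qed

end

section \<open>Random delays\<close>

text \<open>The explicit O-constant; neither \<beta>, \<tau> nor \<epsilon> is an argument. \<rho>
  is the fraction of the maximal step that is used, which makes 1 / \<eta> of order \<tau> / (\<rho>
  \<beta>). The number 7 \<Lambda> + 6 arises from 3 + (7 \<Lambda> + 3) \<tau> <= (7 \<Lambda> + 6)
  \<tau>.\<close>

definition complexity_const :: "real \<Rightarrow> real \<Rightarrow> real \<Rightarrow> real \<Rightarrow> real \<Rightarrow> real" where
  "complexity_const s \<gamma> \<rho> a n = 6 * s * a + 2 * sqrt (2 * s ^ 3 / \<gamma>) * n * (7 * (1 + s - \<gamma>) + 6) / (3 * \<rho>)"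

context afp_delayed
begin

lemma path:
  assumes "\<omega> \<in> space M"
  shows "afp_path G \<beta> s \<gamma> \<eta> \<tau> (\<lambda>k. d k \<omega>) y0 (\<lambda>k. x k \<omega>) (\<lambda>k. y k \<omega>) (\<lambda>k. z k \<omega>)"
  by unfold_locales
    (use assms beta_pos G_cocoercive tau_ge_1 delay_bound gamma_pos gamma_le_1 s_ge eta_pos eta_le scheme in auto)

section \<open>Measurability\<close>

lemma G_measurable: "G \<in> borel_measurable borel"
proof -
  \<comment> \<open>Any sample point will do: a single trajectory gives access to the continuity of
    G.\<close>
  obtain \<omega> where "\<omega> \<in> space M" using not_empty by auto
  then show ?thesis using afp_path.G_continuous[OF path] by (intro borel_measurable_continuous_onI)
qed

text \<open>The delayed index may point to any earlier iterate, hence the hypothesis on all j <= k.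
  Composition with the delay is measurable because it takes countably many values.\<close>

lemma yz_measurable: "(\<forall>j\<le>k. y j \<in> borel_measurable M) \<and> z k \<in> borel_measurable M"
proof (induction k)
  case 0
  have "y 0 \<in> borel_measurable M \<longleftrightarrow> (\<lambda>_. y0) \<in> borel_measurable M"
    by (rule measurable_cong) (rule afp_path.y_zero[OF path])
  moreover have "z 0 \<in> borel_measurable M \<longleftrightarrow> (\<lambda>_. y0) \<in> borel_measurable M"
    by (rule measurable_cong) (rule afp_path.z_zero[OF path])
  ultimately show ?case by simp
next
  case (Suc k)
  have [measurable]: "z k \<in> borel_measurable M" "y k \<in> borel_measurable M" using Suc by auto
  have [measurable]: "(\<lambda>\<omega>. y (k - d k \<omega>) \<omega>) \<in> borel_measurable M"
  proof (rule measurable_compose_countable[where f = "\<lambda>i. y (k - i)"])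
    show "y (k - i) \<in> borel_measurable M" for i using Suc by simp
    show "d k \<in> measurable M (count_space UNIV)" by (rule delay_measurable)
  qed
  let ?h = "\<lambda>\<omega>. G (y (k - d k \<omega>) \<omega>)"
  have h [measurable]: "?h \<in> borel_measurable M"
    by (rule measurable_compose[OF _ G_measurable]) measurable
  have "(\<lambda>\<omega>. y k \<omega> - (s / afp_t s \<tau> k) *\<^sub>R (y k \<omega> - z k \<omega>) -
      (\<eta> / 2 + \<gamma> * \<eta> / (2 * (afp_t s \<tau> k - s))) *\<^sub>R ?h \<omega>) \<in> borel_measurable M"
    by measurable
  also have "?this \<longleftrightarrow> y (Suc k) \<in> borel_measurable M"
    by (rule measurable_cong) (simp only: afp_path.y_Suc[OF path] afp_path.\<mu>_def[OF path])
  finally have y: "y (Suc k) \<in> borel_measurable M" .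
  have "(\<lambda>\<omega>. z k \<omega> - (\<gamma> * afp_eta \<eta> s \<tau> k / s) *\<^sub>R ?h \<omega>) \<in> borel_measurable M"
    by measurable
  also have "?this \<longleftrightarrow> z (Suc k) \<in> borel_measurable M"
    by (rule measurable_cong) (simp only: afp_path.z_Suc[OF path])
  finally have "z (Suc k) \<in> borel_measurable M" .
  with y Suc show ?case by (auto simp: le_Suc_eq)
qed

lemma y_measurable [measurable]: "y k \<in> borel_measurable M"
  and z_measurable [measurable]: "z k \<in> borel_measurable M"
  using yz_measurable[of k] by auto

definition R0sq :: "real ^ 'n \<Rightarrow> real" where
  "R0sq xs = \<eta> * (3 * s + real \<tau> - 1)\<^sup>2 / 2 * (norm (G y0))\<^sup>2 + 2 * s ^ 3 / (\<eta> * \<gamma>) * (norm (y0 - xs))\<^sup>2"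

abbreviation "EG k \<equiv> expectation (\<lambda>\<omega>. (norm (G (y k \<omega>)))\<^sup>2)"

lemma norm_G_y_le:
  assumes "xs \<in> zer G" "\<omega> \<in> space M"
  shows "(norm (G (y k \<omega>)))\<^sup>2 \<le> 4 * R0sq xs / (\<eta> * (real k + 3 * s + real \<tau> - 1)\<^sup>2)"
  using afp_path.norm_g_le[OF path[OF assms(2)] assms(1), of k] afp_path.R0sq_def[OF path[OF assms(2)], of xs]
  by (simp add: R0sq_def)

lemma G_y_measurable [measurable]: "(\<lambda>\<omega>. (norm (G (y k \<omega>)))\<^sup>2) \<in> borel_measurable M"
proof -
  have [measurable]: "(\<lambda>\<omega>. G (y k \<omega>)) \<in> borel_measurable M"
    by (rule measurable_compose[OF y_measurable G_measurable])
  show ?thesis by measurable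
qed

lemma integrable_G_y: "integrable M (\<lambda>\<omega>. (norm (G (y k \<omega>)))\<^sup>2)"
proof -
  obtain xs where "xs \<in> zer G" using zer_nonempty by auto
  then show ?thesis using norm_G_y_le[of xs _ k]
    by (intro integrable_const_bound[where B = "4 * R0sq xs / (\<eta> * (real k + 3 * s + real \<tau> - 1)\<^sup>2)"]) auto
qed

lemma EG_le:
  assumes "xs \<in> zer G"
  shows "EG k \<le> 4 * R0sq xs / (\<eta> * (real k + 3 * s + real \<tau> - 1)\<^sup>2)"
  using norm_G_y_le[OF assms] by (intro integral_le_const integrable_G_y) auto

text \<open>Dominated convergence: multiplied by (k + \<tau>)^2, the pathwise rate is bounded by a
  constant independent of k and of the sample point.\<close>

lemma EG_tendsto_0: "(\<lambda>k. (real k + real \<tau>)\<^sup>2 * EG k) \<longlonglongrightarrow> 0"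
proof -
  obtain xs where xs: "xs \<in> zer G" using zer_nonempty by auto
  have "(\<lambda>k. LINT \<omega>|M. (real k + real \<tau>)\<^sup>2 * (norm (G (y k \<omega>)))\<^sup>2) \<longlonglongrightarrow> (LINT \<omega>|M. 0)"
  proof (rule integral_dominated_convergence[where w = "\<lambda>_. 4 * R0sq xs / \<eta>"])
    show "AE \<omega> in M. (\<lambda>k. (real k + real \<tau>)\<^sup>2 * (norm (G (y k \<omega>)))\<^sup>2) \<longlonglongrightarrow> 0"
      using afp_path.rate_tendsto_0[OF path xs] by auto
    show "AE \<omega> in M. norm ((real k + real \<tau>)\<^sup>2 * (norm (G (y k \<omega>)))\<^sup>2) \<le> 4 * R0sq xs / \<eta>" for k
    proof (intro AE_I2)
      fix \<omega> assume \<omega>: "\<omega> \<in> space M"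
      let ?t = "real k + 3 * s + real \<tau> - 1"
      have t: "real k + real \<tau> \<le> ?t" "?t > 0" using s_ge gamma_pos by auto
      have "(real k + real \<tau>)\<^sup>2 * (norm (G (y k \<omega>)))\<^sup>2 \<le> ?t\<^sup>2 * (4 * R0sq xs / (\<eta> * ?t\<^sup>2))"
        using t norm_G_y_le[OF xs \<omega>, of k] by (intro mult_mono power_mono) auto
      also have "\<dots> = 4 * R0sq xs / \<eta>" using t by simp
      finally show "norm ((real k + real \<tau>)\<^sup>2 * (norm (G (y k \<omega>)))\<^sup>2) \<le> 4 * R0sq xs / \<eta>" by simp
    qed
  qed auto
  then show ?thesis by simp
qed

lemma iterates_AE_converge:
  "\<exists>X \<in> borel_measurable M. (\<forall>\<omega>\<in>space M. X \<omega> \<in> zer G) \<and>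
     (AE \<omega> in M. (\<lambda>k. x k \<omega>) \<longlonglongrightarrow> X \<omega> \<and> (\<lambda>k. y k \<omega>) \<longlonglongrightarrow> X \<omega> \<and> (\<lambda>k. z k \<omega>) \<longlonglongrightarrow> X \<omega>)"
proof -
  \<comment> \<open>The limit is taken along z, all of whose members are measurable; x at 0 is an
    arbitrary function.\<close>
  define X where "X \<omega> = lim (\<lambda>k. z k \<omega>)" for \<omega>
  have X: "X \<omega> \<in> zer G \<and> (\<lambda>k. x k \<omega>) \<longlonglongrightarrow> X \<omega> \<and> (\<lambda>k. y k \<omega>) \<longlonglongrightarrow> X \<omega> \<and> (\<lambda>k. z k \<omega>) \<longlonglongrightarrow> X \<omega>"
    if "\<omega> \<in> space M" for \<omega>
    by (rule afp_path.iterates_converge[OF path[OF that] zer_nonempty]) (simp add: X_def limI)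
  have "X \<in> borel_measurable M"
    by (rule borel_measurable_LIMSEQ_metric[of z]) (use X in auto)
  with X show ?thesis by (intro bexI[of _ X]) auto
qed

lemma complexity:
  assumes xs: "xs \<in> zer G" and "\<epsilon> > 0"
  shows "\<exists>N :: nat. real N \<le> complexity_const s \<gamma> (\<eta> / afp_eta_max \<beta> s \<gamma> \<tau>) (norm (G y0)) (norm (y0 - xs))
      * (real \<tau> / \<epsilon> + real \<tau> / (\<beta> * \<epsilon>)) \<and> (\<forall>k\<ge>N. EG k \<le> \<epsilon>\<^sup>2)"
proof -
  define T a n where "T = real \<tau>" and "a = norm (G y0)" and "n = norm (y0 - xs)"
  define r where "r = sqrt (2 * s ^ 3 / \<gamma>)"
  define K where "K = 7 * (1 + s - \<gamma>) + 6"
  define \<rho> where "\<rho> = \<eta> / afp_eta_max \<beta> s \<gamma> \<tau>"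
  have pos: "T \<ge> 1" "s > 1" "\<eta> > 0" "\<beta> > 0" "\<gamma> > 0" "\<epsilon> > 0" "a \<ge> 0" "n \<ge> 0" "K > 0"
    using tau_ge_1 s_ge gamma_pos gamma_le_1 eta_pos beta_pos assms(2) by (auto simp: T_def a_def n_def K_def)
  have r: "r > 0" "r\<^sup>2 = 2 * s ^ 3 / \<gamma>" using pos by (auto simp: r_def)
  have emax: "afp_eta_max \<beta> s \<gamma> \<tau> = 3 * \<beta> / (3 + (K - 3) * T)" "3 + (K - 3) * T > 0"
    using pos gamma_le_1 by (auto simp: afp_eta_max_def K_def T_def intro!: add_pos_nonneg)
  then have rho: "\<rho> > 0" using pos by (simp add: \<rho>_def)
  have inv: "1 / \<eta> \<le> K * T / (3 * \<rho> * \<beta>)"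
  proof -
    have "1 / \<eta> = (3 + (K - 3) * T) / (3 * \<rho> * \<beta>)"
      using pos emax(2) by (simp add: \<rho>_def emax(1))
    also have "\<dots> \<le> K * T / (3 * \<rho> * \<beta>)"
      using pos rho by (intro divide_right_mono) (auto simp: algebra_simps)
    finally show ?thesis .
  qed
  \<comment> \<open>An upper bound for the square root of R0sq / \<eta> that is linear in T: the
    root of a sum is at most the sum of the roots, and 3 s + T - 1 <= 3 s T.\<close>
  define Q where "Q = 3 * s * T * a + r * n / \<eta>"
  have Q: "Q \<ge> 0" "R0sq xs / \<eta> \<le> Q\<^sup>2"
  proof -
    show "Q \<ge> 0" using pos r by (simp add: Q_def)
    have "3 * s + T - 1 \<le> 3 * s * T"
    proof -
      have "0 \<le> (3 * s - 1) * (T - 1)" using pos by simp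
      then show ?thesis by (simp add: algebra_simps)
    qed
    then have "(3 * s + T - 1)\<^sup>2 \<le> (3 * s * T)\<^sup>2" using pos by (intro power_mono) auto
    then have "(3 * s + T - 1)\<^sup>2 * a\<^sup>2 \<le> (3 * s * T)\<^sup>2 * a\<^sup>2" by (rule mult_right_mono) simp
    moreover have "R0sq xs / \<eta> = (3 * s + T - 1)\<^sup>2 * a\<^sup>2 / 2 + r\<^sup>2 * n\<^sup>2 / \<eta>\<^sup>2"
      using pos unfolding r(2) by (simp add: R0sq_def T_def a_def n_def field_simps power2_eq_square)
    moreover have "0 \<le> (3 * s * T)\<^sup>2 * a\<^sup>2" by simp
    moreover have "Q\<^sup>2 = (3 * s * T)\<^sup>2 * a\<^sup>2 + r\<^sup>2 * n\<^sup>2 / \<eta>\<^sup>2 + 2 * (3 * s * T * a) * (r * n / \<eta>)"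
      by (simp add: Q_def power2_sum power_mult_distrib power_divide)
    moreover have "0 \<le> 2 * (3 * s * T * a) * (r * n / \<eta>)" using pos r by simp
    ultimately show "R0sq xs / \<eta> \<le> Q\<^sup>2" by linarith
  qed
  \<comment> \<open>Rounding down suffices: k + 3 s + \<tau> - 1 >= N + 1 makes up for the fraction
    lost, so the bound on N needs no additive constant.\<close>
  define N where "N = nat \<lfloor>2 * Q / \<epsilon>\<rfloor>"
  have "real N \<le> 2 * Q / \<epsilon>" using Q pos by (simp add: N_def)
  also have "\<dots> \<le> complexity_const s \<gamma> \<rho> a n * (T / \<epsilon> + T / (\<beta> * \<epsilon>))"
  proof -
    define u w where "u = 6 * s * a" and "w = 2 * r * n * K / (3 * \<rho>)"
    have uw: "u \<ge> 0" "w \<ge> 0" using pos r rho by (auto simp: u_def w_def)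
    have "r * n * (1 / \<eta>) \<le> r * n * (K * T / (3 * \<rho> * \<beta>))" using inv r pos by (intro mult_left_mono) auto
    then have "2 * Q \<le> u * T + w * (T / \<beta>)" by (simp add: Q_def u_def w_def)
    also have "\<dots> \<le> (u + w) * (T + T / \<beta>)"
    proof -
      have "0 \<le> u * (T / \<beta>) + w * T" using uw pos by simp
      moreover have "(u + w) * (T + T / \<beta>) = u * T + w * (T / \<beta>) + (u * (T / \<beta>) + w * T)"
        by (simp add: algebra_simps add_divide_distrib)
      ultimately show ?thesis by linarith
    qed
    finally have "2 * Q / \<epsilon> \<le> (u + w) * (T + T / \<beta>) / \<epsilon>" using pos by (intro divide_right_mono) auto
    also have "\<dots> = (u + w) * (T / \<epsilon> + T / (\<beta> * \<epsilon>))" using pos by (simp add: field_simps)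
    also have "u + w = complexity_const s \<gamma> \<rho> a n"
      by (simp add: complexity_const_def u_def w_def r_def K_def)
    finally show ?thesis .
  qed
  finally have N: "real N \<le> complexity_const s \<gamma> \<rho> a n * (T / \<epsilon> + T / (\<beta> * \<epsilon>))" .
  have "EG k \<le> \<epsilon>\<^sup>2" if "k \<ge> N" for k
  proof -
    let ?t = "real k + 3 * s + T - 1"
    have "2 * Q / \<epsilon> < real N + 1" using Q pos unfolding N_def by linarith
    also have "\<dots> \<le> ?t" using that pos by simp
    finally have t: "2 * Q \<le> \<epsilon> * ?t" "?t > 0" using pos by (simp_all add: field_simps)
    have "EG k \<le> 4 * R0sq xs / (\<eta> * ?t\<^sup>2)" using EG_le[OF xs, of k] by (simp add: T_def)
    also have "\<dots> = 4 * (R0sq xs / \<eta>) / ?t\<^sup>2" by simp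
    also have "\<dots> \<le> 4 * Q\<^sup>2 / ?t\<^sup>2" using Q by (intro divide_right_mono mult_left_mono) auto
    also have "4 * Q\<^sup>2 = (2 * Q)\<^sup>2" by (simp add: power_mult_distrib)
    also have "\<dots> / ?t\<^sup>2 \<le> (\<epsilon> * ?t)\<^sup>2 / ?t\<^sup>2" using t Q by (intro divide_right_mono power_mono) auto
    also have "\<dots> = \<epsilon>\<^sup>2" using t by (simp add: power_mult_distrib)
    finally show ?thesis .
  qed
  with N show ?thesis unfolding \<rho>_def T_def a_def n_def by blast
qed

end

theorem corollary1:
  "\<exists>C :: real \<Rightarrow> real \<Rightarrow> real \<Rightarrow> real \<Rightarrow> real \<Rightarrow> real.
   \<forall>(M :: 'w measure) (G :: real ^ 'n \<Rightarrow> real ^ 'n) \<beta> s \<gamma> \<eta> (\<tau> :: nat) d y0 x y z xstar.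
     afp_delayed M G \<beta> s \<gamma> \<eta> \<tau> d y0 x y z \<longrightarrow> xstar \<in> zer G \<longrightarrow>
     (let R0sq = \<eta> * (3 * s + real \<tau> - 1)\<^sup>2 / 2 * (norm (G y0))\<^sup>2
                 + 2 * s ^ 3 / (\<eta> * \<gamma>) * (norm (y0 - xstar))\<^sup>2;
          EG = (\<lambda>k. prob_space.expectation M (\<lambda>\<omega>. (norm (G (y k \<omega>)))\<^sup>2))
      in
        ((\<forall>k. integrable M (\<lambda>\<omega>. (norm (G (y k \<omega>)))\<^sup>2)) \<and>
         (\<forall>k. EG k \<le> 4 * R0sq / (\<eta> * (real k + 3 * s + real \<tau> - 1)\<^sup>2)) \<and>
         (\<lambda>k. (real k + real \<tau>)\<^sup>2 * EG k) \<longlonglongrightarrow> 0) \<and>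
        ((AE \<omega> in M. summable (\<lambda>k. (real k + real \<tau>) * (norm (G (y k \<omega>)))\<^sup>2)) \<and>
         (AE \<omega> in M. (\<lambda>k. (real k + real \<tau>)\<^sup>2 * (norm (G (y k \<omega>)))\<^sup>2) \<longlonglongrightarrow> 0) \<and>
         (\<exists>X \<in> borel_measurable M. (\<forall>\<omega>\<in>space M. X \<omega> \<in> zer G) \<and>
            (AE \<omega> in M. (\<lambda>k. x k \<omega>) \<longlonglongrightarrow> X \<omega> \<and> (\<lambda>k. y k \<omega>) \<longlonglongrightarrow> X \<omega> \<and> (\<lambda>k. z k \<omega>) \<longlonglongrightarrow> X \<omega>))) \<and>
        (\<forall>\<epsilon>>0. \<exists>N :: nat.
           real N \<le> C s \<gamma> (\<eta> / afp_eta_max \<beta> s \<gamma> \<tau>) (norm (G y0)) (norm (y0 - xstar))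
                      * (real \<tau> / \<epsilon> + real \<tau> / (\<beta> * \<epsilon>)) \<and>
           (\<forall>k\<ge>N. EG k \<le> \<epsilon>\<^sup>2)))"
proof (intro exI[of _ complexity_const] allI impI)
  fix M :: "'w measure" and G :: "real ^ 'n \<Rightarrow> real ^ 'n" and \<beta> s \<gamma> \<eta> and \<tau> :: nat
    and d y0 x y z xstar
  assume "afp_delayed M G \<beta> s \<gamma> \<eta> \<tau> d y0 x y z" and xs: "xstar \<in> zer G"
  then interpret afp_delayed M G \<beta> s \<gamma> \<eta> \<tau> d y0 x y z by simp
  have summable: "AE \<omega> in M. summable (\<lambda>k. (real k + real \<tau>) * (norm (G (y k \<omega>)))\<^sup>2)"
    using afp_path.summable_rate[OF path xs] by auto
  have rate: "AE \<omega> in M. (\<lambda>k. (real k + real \<tau>)\<^sup>2 * (norm (G (y k \<omega>)))\<^sup>2) \<longlonglongrightarrow> 0"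
    using afp_path.rate_tendsto_0[OF path xs] by auto
  show "let R0sq = \<eta> * (3 * s + real \<tau> - 1)\<^sup>2 / 2 * (norm (G y0))\<^sup>2
                 + 2 * s ^ 3 / (\<eta> * \<gamma>) * (norm (y0 - xstar))\<^sup>2;
          EG = (\<lambda>k. prob_space.expectation M (\<lambda>\<omega>. (norm (G (y k \<omega>)))\<^sup>2))
      in
        ((\<forall>k. integrable M (\<lambda>\<omega>. (norm (G (y k \<omega>)))\<^sup>2)) \<and>
         (\<forall>k. EG k \<le> 4 * R0sq / (\<eta> * (real k + 3 * s + real \<tau> - 1)\<^sup>2)) \<and>
         (\<lambda>k. (real k + real \<tau>)\<^sup>2 * EG k) \<longlonglongrightarrow> 0) \<and>
        ((AE \<omega> in M. summable (\<lambda>k. (real k + real \<tau>) * (norm (G (y k \<omega>)))\<^sup>2)) \<and>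
         (AE \<omega> in M. (\<lambda>k. (real k + real \<tau>)\<^sup>2 * (norm (G (y k \<omega>)))\<^sup>2) \<longlonglongrightarrow> 0) \<and>
         (\<exists>X \<in> borel_measurable M. (\<forall>\<omega>\<in>space M. X \<omega> \<in> zer G) \<and>
            (AE \<omega> in M. (\<lambda>k. x k \<omega>) \<longlonglongrightarrow> X \<omega> \<and> (\<lambda>k. y k \<omega>) \<longlonglongrightarrow> X \<omega> \<and> (\<lambda>k. z k \<omega>) \<longlonglongrightarrow> X \<omega>))) \<and>
        (\<forall>\<epsilon>>0. \<exists>N :: nat.
           real N \<le> complexity_const s \<gamma> (\<eta> / afp_eta_max \<beta> s \<gamma> \<tau>) (norm (G y0)) (norm (y0 - xstar))
                      * (real \<tau> / \<epsilon> + real \<tau> / (\<beta> * \<epsilon>)) \<and>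
           (\<forall>k\<ge>N. EG k \<le> \<epsilon>\<^sup>2))"
    unfolding Let_def R0sq_def[symmetric]
    using integrable_G_y EG_le[OF xs] EG_tendsto_0 summable rate iterates_AE_converge complexity[OF xs]
    by blast
qed

end
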